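(* (Generalized Ozawa inequality for joint measurement errors.) Let $\rho$ and $\rho_{\mathrm{app}}$ be states of the system and of the apparatus, with largest and smallest eigenvalues $\lambda_{\max},\lambda_{\min}$ and $\mu_{\max},\mu_{\min}$ respectively, such that $\lambda_{\max}\mu_{\max}\neq\lambda_{\min}\mu_{\min}$. Let $A,B$ be observables of the system, let $A_{\mathrm{app}},B_{\mathrm{app}}$ be commuting meter observables of the apparatus, and let $U$ be a unitary on the composite system. Then $$\varepsilon(A)\varepsilon(B)+\varepsilon(A)\sigma(B)+\sigma(A)\varepsilon(B)\ \ge\ \frac{\lambda_{\max}\mu_{\max}+\lambda_{\min}\mu_{\min}}{2\bigl(\lambda_{\max}\mu_{\max}-\lambda_{\min}\mu_{\min}\bigr)}\,\bigl|\langle[A,B]\rangle_\rho\bigr| .$$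
   Context: The system and the apparatus have complex separable Hilbert spaces $\mathcal{H}$ and $\mathcal{K}$; the composite system has Hilbert space $\mathcal{H}\otimes\mathcal{K}$ and initial state $\rho\otimes\rho_{\mathrm{app}}$. States are positive semidefinite trace-class operators of trace one; observables are (bounded) Hermitian operators. In infinite dimension the smallest eigenvalue of a state is understood as the infimum of its spectrum, i.e. $0$. $\langle X\rangle_\rho:=\operatorname{Tr}[X\rho]$, $[A,B]:=AB-BA$, and $\sigma(X):=\sqrt{\operatorname{Tr}[(X-\langle X\rangle_\rho\mathbb{I})^2\rho]}$ is the standard deviation of $X$ in $\rho$. $U$ is the unitary operator on $\mathcal{H}\otimes\mathcal{K}$ describing the measurement interaction. For $X=A,B$, the noise operator is $N_X:=U^\dagger(\mathbb{I}\otimes X_{\mathrm{app}})U-X\otimes\mathbb{I}$ and the error is $\varepsilon(X):=\sqrt{\operatorname{Tr}[(\rho\otimes\rho_{\mathrm{app}})N_X^2]}$. *)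

theory Defs
  imports "HOL-Analysis.Analysis"
begin

section \<open>Complex Hilbert spaces\<close>

class complex_vector = real_vector +
  fixes scaleC :: "complex \<Rightarrow> 'a \<Rightarrow> 'a" (infixr \<open>*\<^sub>C\<close> 75)
  assumes scaleC_add_right: "c *\<^sub>C (x + y) = c *\<^sub>C x + c *\<^sub>C y"
    and scaleC_add_left: "(c + d) *\<^sub>C x = c *\<^sub>C x + d *\<^sub>C x"
    and scaleC_scaleC: "c *\<^sub>C d *\<^sub>C x = (c * d) *\<^sub>C x"
    and scaleC_of_real: "complex_of_real r *\<^sub>C x = r *\<^sub>R x"

text \<open>
  The real inner product inherited from \<^class>\<open>real_inner\<close> is the real part of the complex one,
  so that the norm is the one induced by the complex inner product. The latter is
  conjugate-linear in its first and linear in its second argument.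
\<close>

class complex_inner = complex_vector + real_inner +
  fixes cinner :: "'a \<Rightarrow> 'a \<Rightarrow> complex"
  assumes cinner_commute: "cinner x y = cnj (cinner y x)"
    and cinner_add_right: "cinner x (y + z) = cinner x y + cinner x z"
    and cinner_scaleC_right: "cinner x (c *\<^sub>C y) = c * cinner x y"
    and inner_eq_Re_cinner: "inner x y = Re (cinner x y)"

class chilbert_space = complex_inner + complete_space

global_interpretation complex_vector:
  vector_space "scaleC :: complex \<Rightarrow> 'a \<Rightarrow> 'a::complex_vector"
  defines cspan = "complex_vector.span"
proof
  fix c d :: complex and x y :: 'a
  show "1 *\<^sub>C x = x" using scaleC_of_real[of 1 x] by simp
qed (simp_all add: scaleC_add_right scaleC_add_left scaleC_scaleC)

definition is_onb :: "'a::complex_inner set \<Rightarrow> bool" where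
  "is_onb E \<longleftrightarrow> (\<forall>e\<in>E. norm e = 1) \<and> (\<forall>e\<in>E. \<forall>f\<in>E. e \<noteq> f \<longrightarrow> cinner e f = 0) \<and>
     closure (cspan E) = UNIV"

section \<open>Operators\<close>

definition bounded_clinear :: "('a::complex_inner \<Rightarrow> 'b::complex_inner) \<Rightarrow> bool" where
  "bounded_clinear T \<longleftrightarrow> bounded_linear T \<and> (\<forall>c x. T (c *\<^sub>C x) = c *\<^sub>C T x)"

definition cadjoint :: "('a::complex_inner \<Rightarrow> 'b::complex_inner) \<Rightarrow> 'b \<Rightarrow> 'a" where
  "cadjoint T = (THE S. \<forall>x y. cinner (S y) x = cinner y (T x))"

definition hermitian_op :: "('a::complex_inner \<Rightarrow> 'a) \<Rightarrow> bool" where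
  "hermitian_op T \<longleftrightarrow> bounded_clinear T \<and> (\<forall>x y. cinner (T x) y = cinner x (T y))"

definition unitary_op :: "('a::complex_inner \<Rightarrow> 'a) \<Rightarrow> bool" where
  "unitary_op U \<longleftrightarrow> bounded_clinear U \<and> cadjoint U \<circ> U = id \<and> U \<circ> cadjoint U = id"

definition positive_op :: "('a::complex_inner \<Rightarrow> 'a) \<Rightarrow> bool" where
  "positive_op T \<longleftrightarrow> bounded_clinear T \<and> (\<forall>x. cinner x (T x) \<in> \<real>\<^sub>\<ge>\<^sub>0)"

definition commutator :: "('a::complex_inner \<Rightarrow> 'a) \<Rightarrow> ('a \<Rightarrow> 'a) \<Rightarrow> 'a \<Rightarrow> 'a" where
  "commutator S T = (\<lambda>x. S (T x) - T (S x))"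

text \<open>
  On a Hilbert space every bounded operator \<open>T\<close> has a unique absolute value
  \<open>(T\<^sup>\<dagger> T)\<^sup>1\<^sup>/\<^sup>2\<close>, the positive square root of \<open>T\<^sup>\<dagger> T\<close>.
\<close>

definition abs_op :: "('a::complex_inner \<Rightarrow> 'a) \<Rightarrow> 'a \<Rightarrow> 'a" where
  "abs_op T = (THE P. positive_op P \<and> P \<circ> P = cadjoint T \<circ> T)"

definition trace_class :: "('a::complex_inner \<Rightarrow> 'a) \<Rightarrow> bool" where
  "trace_class T \<longleftrightarrow> bounded_clinear T \<and>
     (\<exists>E. is_onb E \<and> (\<lambda>e. cinner e (abs_op T e)) summable_on E)"

text \<open>The trace of a trace-class operator does not depend on the orthonormal basis chosen.\<close>

definition ctrace :: "('a::complex_inner \<Rightarrow> 'a) \<Rightarrow> complex" where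
  "ctrace T = (\<Sum>\<^sub>\<infinity>e\<in>(SOME E. is_onb E). cinner e (T e))"

section \<open>Eigenvalues and spectrum\<close>

definition eigenvalues :: "('a::complex_inner \<Rightarrow> 'a) \<Rightarrow> complex set" where
  "eigenvalues T = {c. \<exists>x. x \<noteq> 0 \<and> T x = c *\<^sub>C x}"

definition spectrum_op :: "('a::complex_inner \<Rightarrow> 'a) \<Rightarrow> complex set" where
  "spectrum_op T = {c. \<nexists>R. bounded_clinear R \<and>
     R \<circ> (\<lambda>x. T x - c *\<^sub>C x) = id \<and> (\<lambda>x. T x - c *\<^sub>C x) \<circ> R = id}"

text \<open>
  The following two are meant for states. A state is a nonzero positive compact operator, so a
  largest eigenvalue exists in any dimension, while a smallest one need not exist in infinite
  dimension.
\<close>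

definition largest_eigenvalue :: "('a::complex_inner \<Rightarrow> 'a) \<Rightarrow> real" where
  "largest_eigenvalue T = (GREATEST r. complex_of_real r \<in> eigenvalues T)"

definition smallest_eigenvalue :: "('a::complex_inner \<Rightarrow> 'a) \<Rightarrow> real" where
  "smallest_eigenvalue T =
     (if \<exists>S::'a set. finite S \<and> cspan S = UNIV
      then (LEAST r. complex_of_real r \<in> eigenvalues T)
      else Inf {r. complex_of_real r \<in> spectrum_op T})"

section \<open>Tensor products\<close>

text \<open>
  A Hilbert space \<open>'c\<close> together with a map \<open>t\<close> as below is a realisation of the Hilbert space tensor
  product of \<open>'a\<close> and \<open>'b\<close>: the span of the elementary tensors is the algebraic tensor product with
  its canonical inner product, and \<open>'c\<close> is its completion. This determines \<open>'c\<close> and \<open>t\<close> up to a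
  unique unitary isomorphism.
\<close>

definition is_tensor_product ::
    "('a::chilbert_space \<Rightarrow> 'b::chilbert_space \<Rightarrow> 'c::chilbert_space) \<Rightarrow> bool" where
  "is_tensor_product t \<longleftrightarrow>
     (\<forall>y. Vector_Spaces.linear scaleC scaleC (\<lambda>x. t x y)) \<and>
     (\<forall>x. Vector_Spaces.linear scaleC scaleC (\<lambda>y. t x y)) \<and>
     (\<forall>x y x' y'. cinner (t x y) (t x' y') = cinner x x' * cinner y y') \<and>
     closure (cspan {t x y | x y. True}) = UNIV"

text \<open>
  The tensor product of bounded operators \<open>S\<close> and \<open>T\<close> is the unique bounded operator with the
  expected values on elementary tensors.
\<close>

definition tensor_op ::
    "('a::chilbert_space \<Rightarrow> 'b::chilbert_space \<Rightarrow> 'c::chilbert_space) \<Rightarrow>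
     ('a \<Rightarrow> 'a) \<Rightarrow> ('b \<Rightarrow> 'b) \<Rightarrow> 'c \<Rightarrow> 'c" where
  "tensor_op t S T = (THE W. bounded_clinear W \<and> (\<forall>x y. W (t x y) = t (S x) (T y)))"

section \<open>States, noise and error\<close>

definition quantum_state :: "('a::chilbert_space \<Rightarrow> 'a) \<Rightarrow> bool" where
  "quantum_state \<rho> \<longleftrightarrow> positive_op \<rho> \<and> trace_class \<rho> \<and> ctrace \<rho> = 1"

definition expectation :: "('a::chilbert_space \<Rightarrow> 'a) \<Rightarrow> ('a \<Rightarrow> 'a) \<Rightarrow> complex" where
  "expectation \<rho> X = ctrace (X \<circ> \<rho>)"

text \<open>
  In the next definition and in that of the error, the trace is a nonnegative real number (for
  Hermitian operators), so that taking its real part only changes the type.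
\<close>

definition std_deviation :: "('a::chilbert_space \<Rightarrow> 'a) \<Rightarrow> ('a \<Rightarrow> 'a) \<Rightarrow> real" where
  "std_deviation \<rho> X =
     (let D = (\<lambda>x. X x - expectation \<rho> X *\<^sub>C x) in sqrt (Re (ctrace (D \<circ> D \<circ> \<rho>))))"

definition noise_op ::
    "('a::chilbert_space \<Rightarrow> 'b::chilbert_space \<Rightarrow> 'c::chilbert_space) \<Rightarrow>
     ('c \<Rightarrow> 'c) \<Rightarrow> ('a \<Rightarrow> 'a) \<Rightarrow> ('b \<Rightarrow> 'b) \<Rightarrow> 'c \<Rightarrow> 'c" where
  "noise_op t U X X\<^sub>a\<^sub>p\<^sub>p =
     (\<lambda>z. (cadjoint U \<circ> tensor_op t id X\<^sub>a\<^sub>p\<^sub>p \<circ> U) z - tensor_op t X id z)"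

definition measurement_error ::
    "('a::chilbert_space \<Rightarrow> 'b::chilbert_space \<Rightarrow> 'c::chilbert_space) \<Rightarrow>
     ('a \<Rightarrow> 'a) \<Rightarrow> ('b \<Rightarrow> 'b) \<Rightarrow> ('c \<Rightarrow> 'c) \<Rightarrow> ('a \<Rightarrow> 'a) \<Rightarrow> ('b \<Rightarrow> 'b) \<Rightarrow> real" where
  "measurement_error t \<rho> \<rho>\<^sub>a\<^sub>p\<^sub>p U X X\<^sub>a\<^sub>p\<^sub>p =
     (let N = noise_op t U X X\<^sub>a\<^sub>p\<^sub>p in sqrt (Re (ctrace (tensor_op t \<rho> \<rho>\<^sub>a\<^sub>p\<^sub>p \<circ> (N \<circ> N)))))"

end

(*
  In an eigenbasis of a state with eigenvalues w in [m, L], the expectation of [X, Y] is the sum of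
  (w_g - w_h) X_gh Y_hg, and |w_g - w_h| <= (L - m) / (L + m) * (w_g + w_h).  The Cauchy-Schwarz
  inequality for the weights w_g + w_h therefore improves Robertson's inequality by the factor
  (L + m) / (L - m).  The shifted meter observables N_X + X (x) 1 - <X> after the interaction commute,
  so the expectation of [A, B] is minus the sum of those of [N_A, N_B], [N_A, B] and [A, N_B], and
  each of the three is bounded by the improved inequality in the product state, whose eigenvalues
  are the products of those of the factors.

  Everything happens in eigenbases, so only the diagonalisation of states is needed: if the trace of
  a positive operator converges in one basis, the operator is Hilbert-Schmidt, hence compact.
*)
theory Submission
  imports Defs
begin

text \<open>The factor (L - m) / (L + m) is the largest value of |u - v| / (u + v) for u, v in
  [m, L], reached at the two ends; for m = 0 it is 1 and Robertson's inequality comes back. What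
  enters is an enclosure of the eigenvalues in [m, L], so for the product state the products of the
  bounds for the factors serve directly. The shift by <X> leaves every commutator unchanged and
  turns the second moment of X \<otimes> 1 into the variance. The obstacle is that
  \<open>ctrace\<close> sums over one unspecified basis. Independence of the basis is therefore
  proved for products X T with T diagonalised and X bounded, where it is an exchange of two
  summations in an absolutely convergent double series. Reading such a trace in an eigenbasis also
  makes the passage from the composite system to the system elementary: operators X \<otimes> 1 act
  on the first factor of a product vector, and the apparatus eigenvalues sum to 1.\<close>

instance chilbert_space \<subseteq> banach ..

section \<open>Complex inner products\<close>

lemma cinner_scaleC_left: "cinner (c *\<^sub>C x) y = cnj c * cinner x y"
  by (metis cinner_commute cinner_scaleC_right complex_cnj_mult)

lemma cinner_add_left: "cinner (x + y) z = cinner x z + cinner y z"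
  by (metis cinner_add_right cinner_commute complex_cnj_add)

lemma cinner_zero_right [simp]: "cinner x 0 = 0"
  using cinner_add_right[of x 0 0] by simp

lemma cinner_zero_left [simp]: "cinner 0 x = 0"
  using cinner_add_left[of 0 0 x] by simp

lemma cinner_minus_right [simp]: "cinner x (- y) = - cinner x y"
  using cinner_add_right[of x y "- y"] by (simp add: add_eq_0_iff)

lemma cinner_minus_left [simp]: "cinner (- x) y = - cinner x y"
  using cinner_add_left[of x "- x" y] by (simp add: add_eq_0_iff)

lemma cinner_diff_right: "cinner x (y - z) = cinner x y - cinner x z"
  using cinner_add_right[of x y "- z"] by simp

lemma cinner_diff_left: "cinner (x - y) z = cinner x z - cinner y z"
  using cinner_add_left[of x "- y" z] by simp

lemma cinner_sum_right: "cinner x (sum f A) = (\<Sum>i\<in>A. cinner x (f i))"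
  by (induction A rule: infinite_finite_induct) (auto simp: cinner_add_right)

lemma cinner_sum_left: "cinner (sum f A) x = (\<Sum>i\<in>A. cinner (f i) x)"
  by (induction A rule: infinite_finite_induct) (auto simp: cinner_add_left)

lemma cinner_self: "cinner x x = complex_of_real ((norm x)\<^sup>2)"
proof (rule complex_eqI)
  have "cnj (cinner x x) = cinner x x" by (metis cinner_commute)
  thus "Im (cinner x x) = Im (complex_of_real ((norm x)\<^sup>2))"
    by (metis Im_complex_of_real Reals_cnj_iff complex_is_Real_iff)
  show "Re (cinner x x) = Re (complex_of_real ((norm x)\<^sup>2))"
    by (metis Re_complex_of_real inner_eq_Re_cinner power2_norm_eq_inner)
qed

lemma cinner_self_eq_0 [simp]: "cinner x x = 0 \<longleftrightarrow> x = 0"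
  by (simp add: cinner_self)

lemma norm_scaleC: "norm (c *\<^sub>C (x::'a::complex_inner)) = cmod c * norm x"
proof -
  have "cinner (c *\<^sub>C x) (c *\<^sub>C x) = (c * cnj c) * cinner x x"
    by (simp add: cinner_scaleC_left cinner_scaleC_right)
  hence "complex_of_real ((norm (c *\<^sub>C x))\<^sup>2) = complex_of_real ((cmod c * norm x)\<^sup>2)"
    by (simp only: cinner_self complex_norm_square[symmetric] power_mult_distrib of_real_mult)
  hence "(norm (c *\<^sub>C x))\<^sup>2 = (cmod c * norm x)\<^sup>2" using of_real_eq_iff by blast
  thus ?thesis by simp
qed

lemma norm_cinner_le: "cmod (cinner x y) \<le> norm x * norm y"
proof (cases "cinner x y = 0")
  case False
  \<comment> \<open>The phase \<open>?u\<close> turns the inner product into its modulus, so that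
    the real Cauchy-Schwarz inequality applies to x and \<open>?u\<close> times y.\<close>
  let ?c = "cinner x y" let ?u = "cnj ?c / cmod ?c"
  have "cinner x (?u *\<^sub>C y) = complex_of_real (cmod ?c)"
    using False by (simp add: cinner_scaleC_right complex_norm_square[symmetric] power2_eq_square mult.commute)
  hence "cmod ?c = inner x (?u *\<^sub>C y)" by (simp add: inner_eq_Re_cinner)
  also have "\<dots> \<le> norm x * norm (?u *\<^sub>C y)" by (rule norm_cauchy_schwarz)
  also have "norm (?u *\<^sub>C y) = norm y" using False by (simp add: norm_scaleC norm_divide)
  finally show ?thesis .
qed simp

lemma scaleR_scaleC: "r *\<^sub>R x = complex_of_real r *\<^sub>C x"
  by (simp add: scaleC_of_real)

lemma bounded_linear_cinner_right: "bounded_linear (cinner x)"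
  by (rule bounded_linear_intro[where K = "norm x"])
     (auto simp: cinner_add_right scaleR_scaleC cinner_scaleC_right norm_cinner_le scaleR_conv_of_real
           mult.commute[of "norm _" "norm x"])

lemma bounded_linear_scaleC_right: "bounded_linear (\<lambda>x::'a::complex_inner. c *\<^sub>C x)"
  by (rule bounded_linear_intro[where K = "cmod c"])
     (auto simp: scaleC_add_right scaleR_scaleC scaleC_scaleC norm_scaleC mult.commute)

lemma bounded_linear_scaleC_left: "bounded_linear (\<lambda>c. c *\<^sub>C (x::'a::complex_inner))"
  by (rule bounded_linear_intro[where K = "norm x"])
     (auto simp: scaleC_add_left scaleR_scaleC scaleC_scaleC norm_scaleC scaleR_conv_of_real)

lemma bounded_linear_cinner_left: "bounded_linear (\<lambda>x. cinner x y)"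
  by (rule bounded_linear_intro[where K = "norm y"])
     (auto simp: cinner_add_left scaleR_scaleC cinner_scaleC_left norm_cinner_le scaleR_conv_of_real)

lemma cinner_eqI:
  assumes "\<And>z. cinner z x = cinner z y" shows "x = y"
  using assms[of "x - y"] cinner_self_eq_0[of "x - y"] by (simp add: cinner_diff_right)

section \<open>Bounded complex-linear maps\<close>

lemma bounded_clinear_bounded_linear: "bounded_clinear T \<Longrightarrow> bounded_linear T"
  by (simp add: bounded_clinear_def)

lemma bounded_clinear_scaleC: "bounded_clinear T \<Longrightarrow> T (c *\<^sub>C x) = c *\<^sub>C T x"
  by (simp add: bounded_clinear_def)

lemma bounded_clinear_add: "bounded_clinear T \<Longrightarrow> T (x + y) = T x + T y"
  by (simp add: bounded_clinear_def linear_add bounded_linear.linear)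

lemma bounded_clinear_diff: "bounded_clinear T \<Longrightarrow> T (x - y) = T x - T y"
  by (simp add: bounded_clinear_def linear_diff bounded_linear.linear)

lemma bounded_clinear_zero: "bounded_clinear T \<Longrightarrow> T 0 = 0"
  by (simp add: bounded_clinear_def linear_0 bounded_linear.linear)

lemma bounded_clinear_sum: "bounded_clinear T \<Longrightarrow> T (sum f A) = (\<Sum>i\<in>A. T (f i))"
  by (simp add: bounded_clinear_def linear_sum bounded_linear.linear)

lemma bounded_clinear_bound:
  assumes "bounded_clinear T"
  obtains K where "K > 0" "\<And>x. norm (T x) \<le> K * norm x"
  using bounded_linear.pos_bounded[OF bounded_clinear_bounded_linear[OF assms]]
  by (metis mult.commute)

lemma bounded_clinear_intro:
  assumes "\<And>x y. T (x + y) = T x + T y" "\<And>c x. T (c *\<^sub>C x) = c *\<^sub>C T x"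
    and "\<And>x. norm (T x) \<le> K * norm x"
  shows "bounded_clinear T"
  unfolding bounded_clinear_def
  by (intro conjI bounded_linear_intro[where K = K])
     (use assms in \<open>auto simp: scaleR_scaleC mult.commute\<close>)

lemma bounded_clinear_id: "bounded_clinear id"
  by (rule bounded_clinear_intro[where K = 1]) auto

lemma bounded_clinear_comp:
  assumes "bounded_clinear S" "bounded_clinear T"
  shows "bounded_clinear (\<lambda>x. S (T x))"
  using assms by (auto simp: bounded_clinear_def bounded_linear_compose)

lemma bounded_clinear_diff_op:
  assumes "bounded_clinear S" "bounded_clinear T"
  shows "bounded_clinear (\<lambda>x. S x - T x)"
  using assms
  by (auto simp: bounded_clinear_def bounded_linear_sub complex_vector.scale_right_diff_distrib)

lemma bounded_clinear_scaleC_op: "bounded_clinear (\<lambda>x. c *\<^sub>C x)"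
  by (auto simp: bounded_clinear_def bounded_linear_scaleC_right scaleC_scaleC mult.commute)

lemma bounded_clinear_isCont: "bounded_clinear T \<Longrightarrow> continuous_on S T"
  by (simp add: bounded_clinear_def linear_continuous_on)

text \<open>The density principle behind most identities below: a closed linear condition that holds
  on generators holds everywhere. Linearity is stated pointwise so that set comprehensions can be
  plugged in directly.\<close>

lemma closed_subspace_UNIV:
  assumes "closure (cspan S) = UNIV" and "S \<subseteq> V" and "closed V"
    and "0 \<in> V" "\<And>x y. x \<in> V \<Longrightarrow> y \<in> V \<Longrightarrow> x + y \<in> V" "\<And>c x. x \<in> V \<Longrightarrow> c *\<^sub>C x \<in> V"
  shows "V = UNIV"
proof -
  have "complex_vector.subspace V"
    by (rule complex_vector.subspaceI) (use assms in auto)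
  hence "cspan S \<subseteq> V" using assms(2) by (rule complex_vector.span_minimal[rotated])
  thus ?thesis using assms(1,3) closure_minimal by blast
qed

lemma bounded_clinear_eq_on_dense:
  assumes "bounded_clinear S" "bounded_clinear T" "closure (cspan E) = UNIV"
    and "\<And>e. e \<in> E \<Longrightarrow> S e = T e"
  shows "S = T"
proof -
  have "{x. S x = T x} = UNIV"
  proof (rule closed_subspace_UNIV[OF assms(3)])
    show "closed {x. S x = T x}"
      by (intro closed_Collect_eq bounded_clinear_isCont assms)
  qed (use assms in \<open>auto simp: bounded_clinear_zero bounded_clinear_add bounded_clinear_scaleC\<close>)
  thus ?thesis by auto
qed

lemma eq_if_cinner_eq_on_dense:
  assumes "closure (cspan E) = UNIV" and "\<And>e. e \<in> E \<Longrightarrow> cinner e x = cinner e y"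
  shows "x = y"
proof -
  have "{z. cinner z (x - y) = 0} = UNIV"
  proof (rule closed_subspace_UNIV[OF assms(1)])
    show "closed {z. cinner z (x - y) = 0}"
      by (intro closed_Collect_eq linear_continuous_on bounded_linear_cinner_left continuous_on_const)
  qed (use assms in \<open>auto simp: cinner_add_left cinner_scaleC_left cinner_diff_right\<close>)
  hence "cinner (x - y) (x - y) = 0" by blast
  thus ?thesis by simp
qed

section \<open>Sums of orthogonal families\<close>

lemma norm_sum_orthogonal:
  assumes "finite F" "\<And>i j. i \<in> F \<Longrightarrow> j \<in> F \<Longrightarrow> i \<noteq> j \<Longrightarrow> cinner (v i) (v j) = 0"
  shows "(norm (\<Sum>i\<in>F. v i))\<^sup>2 = (\<Sum>i\<in>F. (norm (v i))\<^sup>2)"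
proof -
  have "complex_of_real ((norm (\<Sum>i\<in>F. v i))\<^sup>2) = (\<Sum>i\<in>F. \<Sum>j\<in>F. cinner (v j) (v i))"
    by (simp add: cinner_self[symmetric] cinner_sum_left cinner_sum_right del: of_real_power)
  also have "\<dots> = (\<Sum>i\<in>F. \<Sum>j\<in>F. if j = i then cinner (v i) (v i) else 0)"
    by (intro sum.cong refl) (use assms in auto)
  also have "\<dots> = (\<Sum>i\<in>F. cinner (v i) (v i))" using assms(1) by simp
  also have "\<dots> = complex_of_real (\<Sum>i\<in>F. (norm (v i))\<^sup>2)" by (simp add: cinner_self)
  finally show ?thesis using of_real_eq_iff by blast
qed

text \<open>Such a family need not be absolutely summable. By Pythagoras the squared distance
  between two partial sums, one extending the other, is a difference of partial sums of the squared
  norms, so convergence of that real series makes the net of partial sums Cauchy.\<close>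

lemma orthogonal_summable_on:
  fixes v :: "'i \<Rightarrow> 'a::chilbert_space"
  assumes orth: "\<And>i j. i \<in> I \<Longrightarrow> j \<in> I \<Longrightarrow> i \<noteq> j \<Longrightarrow> cinner (v i) (v j) = 0"
    and bound: "\<And>F. finite F \<Longrightarrow> F \<subseteq> I \<Longrightarrow> (\<Sum>i\<in>F. (norm (v i))\<^sup>2) \<le> K\<^sup>2" and "K \<ge> 0"
  shows "v summable_on I" and "norm (infsum v I) \<le> K"
proof -
  let ?q = "\<lambda>i. (norm (v i))\<^sup>2"
  have q: "?q summable_on I"
    by (rule nonneg_bdd_above_summable_on) (auto intro!: bdd_aboveI2 bound)
  have "\<exists>P. eventually P (finite_subsets_at_top I) \<and>
              (\<forall>F F'. P F \<and> P F' \<longrightarrow> dist (sum v F) (sum v F') < e)" if "e > 0" for e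
  proof -
    have "(e/2)\<^sup>2 > 0" using that by simp
    \<comment> \<open>Half of the square leaves room for the strict bound e / 2 on each tail; two
      partial sums are then compared through the sum over \<open>F0\<close>.\<close>
    then obtain F0 where F0: "finite F0" "F0 \<subseteq> I" "dist (sum ?q F0) (infsum ?q I) \<le> (e/2)\<^sup>2 / 2"
      using infsum_finite_approximation[OF q, of "(e/2)\<^sup>2 / 2"] by auto
    have tail: "norm (sum v F - sum v F0) < e / 2" if F: "finite F" "F0 \<subseteq> F" "F \<subseteq> I" for F
    proof -
      have "(norm (sum v F - sum v F0))\<^sup>2 = (norm (sum v (F - F0)))\<^sup>2"
        using F by (simp add: sum_diff)
      also have "\<dots> = sum ?q (F - F0)"
        by (rule norm_sum_orthogonal) (use F in \<open>auto intro!: orth\<close>)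
      also have "\<dots> = sum ?q F - sum ?q F0" using F by (simp add: sum_diff)
      also have "\<dots> \<le> infsum ?q I - sum ?q F0"
        using finite_sum_le_infsum[OF q, of F] F by auto
      also have "\<dots> \<le> (e/2)\<^sup>2 / 2" using F0(3) unfolding dist_real_def by linarith
      also have "\<dots> < (e/2)\<^sup>2" using \<open>(e/2)\<^sup>2 > 0\<close> by linarith
      finally show ?thesis using \<open>e > 0\<close> power_less_imp_less_base[of _ 2 "e/2"] by simp
    qed
    have "dist (sum v F) (sum v F') < e"
      if "finite F" "F0 \<subseteq> F" "F \<subseteq> I" "finite F'" "F0 \<subseteq> F'" "F' \<subseteq> I" for F F'
    proof -
      have "dist (sum v F) (sum v F') \<le> norm (sum v F - sum v F0) + norm (sum v F' - sum v F0)"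
        by (metis dist_norm dist_triangle2)
      thus ?thesis using tail[of F] tail[of F'] that by linarith
    qed
    thus ?thesis using F0
      by (intro exI[of _ "\<lambda>F. finite F \<and> F0 \<subseteq> F \<and> F \<subseteq> I"])
         (auto simp: eventually_finite_subsets_at_top)
  qed
  hence "cauchy_filter (filtermap (sum v) (finite_subsets_at_top I))"
    by (simp add: cauchy_filter_metric_filtermap)
  moreover have "complete (UNIV::'a set)"
    by (meson Cauchy_convergent UNIV_I complete_def convergent_def)
  ultimately obtain L where L: "(sum v \<longlongrightarrow> L) (finite_subsets_at_top I)"
    using complete_uniform[where S=UNIV] by (force simp add: filterlim_def)
  thus "v summable_on I" using summable_on_def has_sum_def by blast
  have "norm L \<le> K"
  proof (rule tendsto_upperbound[OF tendsto_norm[OF L]])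
    show "\<forall>\<^sub>F F in finite_subsets_at_top I. norm (sum v F) \<le> K"
    proof (rule eventually_finite_subsets_at_top_weakI)
      fix F assume F: "finite F" "F \<subseteq> I"
      have "(norm (sum v F))\<^sup>2 = sum ?q F" by (rule norm_sum_orthogonal) (use F orth in auto)
      thus "norm (sum v F) \<le> K" using bound[OF F] \<open>K \<ge> 0\<close> by (metis power2_le_imp_le)
    qed
  qed simp
  thus "norm (infsum v I) \<le> K" using L infsumI has_sum_def by blast
qed

text \<open>All the operators constructed below (adjoints, resolvents, tensor products) are of this form.\<close>

lemma bounded_clinear_infsum:
  fixes W :: "'i \<Rightarrow> 'a::complex_inner \<Rightarrow> 'b::chilbert_space"
  assumes orth: "\<And>i j x. i \<in> I \<Longrightarrow> j \<in> I \<Longrightarrow> i \<noteq> j \<Longrightarrow> cinner (W i x) (W j x) = 0"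
    and bound: "\<And>F x. finite F \<Longrightarrow> F \<subseteq> I \<Longrightarrow> (\<Sum>i\<in>F. (norm (W i x))\<^sup>2) \<le> (K * norm x)\<^sup>2" and "K \<ge> 0"
    and add: "\<And>i x y. i \<in> I \<Longrightarrow> W i (x + y) = W i x + W i y"
    and scale: "\<And>i c x. i \<in> I \<Longrightarrow> W i (c *\<^sub>C x) = c *\<^sub>C W i x"
  shows "\<And>x. (\<lambda>i. W i x) summable_on I" and "bounded_clinear (\<lambda>x. \<Sum>\<^sub>\<infinity>i\<in>I. W i x)"
proof -
  show summ: "(\<lambda>i. W i x) summable_on I" for x
    by (rule orthogonal_summable_on(1)[of I _ "K * norm x"]) (use orth bound \<open>K \<ge> 0\<close> in auto)
  show "bounded_clinear (\<lambda>x. \<Sum>\<^sub>\<infinity>i\<in>I. W i x)"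
  proof (rule bounded_clinear_intro)
    fix x y show "(\<Sum>\<^sub>\<infinity>i\<in>I. W i (x + y)) = (\<Sum>\<^sub>\<infinity>i\<in>I. W i x) + (\<Sum>\<^sub>\<infinity>i\<in>I. W i y)"
      by (subst infsum_add[symmetric]) (auto simp: summ add intro!: infsum_cong)
  next
    fix c x
    have "((\<lambda>i. c *\<^sub>C W i x) has_sum c *\<^sub>C (\<Sum>\<^sub>\<infinity>i\<in>I. W i x)) I"
      by (rule has_sum_bounded_linear[OF bounded_linear_scaleC_right]) (simp add: summ)
    thus "(\<Sum>\<^sub>\<infinity>i\<in>I. W i (c *\<^sub>C x)) = c *\<^sub>C (\<Sum>\<^sub>\<infinity>i\<in>I. W i x)"
      by (intro infsumI) (simp add: scale cong: has_sum_cong)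
  next
    fix x show "norm (\<Sum>\<^sub>\<infinity>i\<in>I. W i x) \<le> K * norm x"
      by (rule orthogonal_summable_on(2)[of I _ "K * norm x"]) (use orth bound \<open>K \<ge> 0\<close> in auto)
  qed
qed

section \<open>Orthonormal bases and adjoints\<close>

definition orthonormal :: "'a::complex_inner set \<Rightarrow> bool" where
  "orthonormal E \<longleftrightarrow> (\<forall>e\<in>E. norm e = 1) \<and> (\<forall>e\<in>E. \<forall>f\<in>E. e \<noteq> f \<longrightarrow> cinner e f = 0)"

lemma is_onb_iff: "is_onb E \<longleftrightarrow> orthonormal E \<and> closure (cspan E) = UNIV"
  by (auto simp: is_onb_def orthonormal_def)

lemma is_onb_orthonormal: "is_onb E \<Longrightarrow> orthonormal E"
  and is_onb_dense: "is_onb E \<Longrightarrow> closure (cspan E) = UNIV"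
  by (auto simp: is_onb_iff)

lemma orthonormal_cinner:
  assumes "orthonormal E" "e \<in> E" "f \<in> E"
  shows "cinner e f = (if e = f then 1 else 0)"
  using assms by (auto simp: orthonormal_def cinner_self)

lemma orthonormal_norm: "orthonormal E \<Longrightarrow> e \<in> E \<Longrightarrow> norm e = 1"
  by (auto simp: orthonormal_def)

text \<open>Needed to see that a basis is finite when the space has a finite spanning set.\<close>

lemma orthonormal_independent:
  assumes "orthonormal E"
  shows "\<not> complex_vector.dependent E"
  unfolding complex_vector.independent_explicit_module
proof (intro allI impI)
  fix F u v assume F: "finite F" "F \<subseteq> E" "(\<Sum>v\<in>F. u v *\<^sub>C v) = 0" "v \<in> F"
  have "0 = cinner v (\<Sum>w\<in>F. u w *\<^sub>C w)" using F by simp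
  also have "\<dots> = (\<Sum>w\<in>F. if w = v then u w else 0)"
    unfolding cinner_sum_right cinner_scaleC_right
    by (intro sum.cong refl) (use F in \<open>auto simp: orthonormal_cinner[OF assms, of v] subset_iff\<close>)
  also have "\<dots> = u v" using F by simp
  finally show "u v = 0" by simp
qed

section \<open>Bessel's inequality and orthonormal expansions\<close>

text \<open>The self-bounding form in which Cauchy-Schwarz delivers Bessel's inequality: the test
  vector has norm sqrt s, so s itself occurs on the right.\<close>

lemma le_square_if_le_mult_sqrt:
  fixes s n :: real
  assumes "s \<le> n * sqrt s" "0 \<le> s" "0 \<le> n"
  shows "s \<le> n\<^sup>2"
proof (cases "s = 0")
  case False
  hence "sqrt s > 0" using assms by simp
  moreover have "sqrt s * sqrt s \<le> n * sqrt s" using assms by simp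
  ultimately have "sqrt s \<le> n" by (rule mult_right_le_imp_le[rotated])
  hence "(sqrt s)\<^sup>2 \<le> n\<^sup>2" by (rule power_mono) (use assms in auto)
  thus ?thesis using assms by simp
qed simp

text \<open>Test the vector \<open>\<Sum>\<langle>T e, y\<rangle> e\<close> against \<open>y\<close> and apply the Cauchy-Schwarz inequality.\<close>

lemma bessel_op:
  assumes E: "orthonormal E" and F: "finite F" "F \<subseteq> E"
    and T: "bounded_clinear T" "\<And>x. norm (T x) \<le> K * norm x" and "K \<ge> 0"
  shows "(\<Sum>e\<in>F. (cmod (cinner (T e) y))\<^sup>2) \<le> (K * norm y)\<^sup>2"
proof -
  define s where "s = (\<Sum>e\<in>F. (cmod (cinner (T e) y))\<^sup>2)"
  define w where "w = (\<Sum>e\<in>F. cinner (T e) y *\<^sub>C e)"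
  have "(norm w)\<^sup>2 = (\<Sum>e\<in>F. (norm (cinner (T e) y *\<^sub>C e))\<^sup>2)"
    unfolding w_def
  proof (rule norm_sum_orthogonal[OF F(1)])
    fix e f assume "e \<in> F" "f \<in> F" "e \<noteq> f"
    thus "cinner (cinner (T e) y *\<^sub>C e) (cinner (T f) y *\<^sub>C f) = 0"
      using F orthonormal_cinner[OF E, of e f] by (auto simp: cinner_scaleC_left cinner_scaleC_right)
  qed
  also have "\<dots> = s" unfolding s_def
    by (intro sum.cong refl) (use F orthonormal_norm[OF E] in \<open>auto simp: norm_scaleC\<close>)
  finally have w: "norm w = sqrt s" by (metis norm_ge_zero real_sqrt_unique)
  have "cinner (T w) y = complex_of_real s"
    by (simp add: w_def s_def bounded_clinear_sum[OF T(1)] bounded_clinear_scaleC[OF T(1)]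
        cinner_sum_left cinner_scaleC_left complex_norm_square mult.commute del: of_real_power)
  hence "\<bar>s\<bar> \<le> norm (T w) * norm y" by (metis norm_cinner_le norm_of_real)
  also have "\<dots> \<le> (K * norm w) * norm y" by (intro mult_right_mono T) auto
  finally have "s \<le> (K * norm y) * sqrt s" by (simp add: w mult_ac)
  thus ?thesis unfolding s_def[symmetric]
    by (rule le_square_if_le_mult_sqrt) (auto simp: s_def \<open>K \<ge> 0\<close> intro: sum_nonneg)
qed

lemma bessel:
  assumes "orthonormal E" "finite F" "F \<subseteq> E"
  shows "(\<Sum>e\<in>F. (cmod (cinner e y))\<^sup>2) \<le> (norm y)\<^sup>2"
  using bessel_op[OF assms bounded_clinear_id, of 1] by simp

text \<open>The sum is the adjoint of T followed by the orthogonal projection onto the closed span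
  of E. Two cases matter: T = id gives the projection, and a basis E gives the adjoint.\<close>

lemma sum_coeff_orthonormal:
  fixes E :: "'a::chilbert_space set" and T :: "'a \<Rightarrow> 'b::complex_inner"
  assumes E: "orthonormal E" and T: "bounded_clinear T"
  shows "\<And>y. (\<lambda>e. cinner (T e) y *\<^sub>C e) summable_on E"
    and "bounded_clinear (\<lambda>y. \<Sum>\<^sub>\<infinity>e\<in>E. cinner (T e) y *\<^sub>C e)"
    and "\<And>e y. e \<in> E \<Longrightarrow> cinner e (\<Sum>\<^sub>\<infinity>e\<in>E. cinner (T e) y *\<^sub>C e) = cinner (T e) y"
proof -
  obtain K where K: "K > 0" "\<And>x. norm (T x) \<le> K * norm x"
    using bounded_clinear_bound[OF T] by blast
  have orth: "cinner (cinner (T e) y *\<^sub>C e) (cinner (T f) y *\<^sub>C f) = 0"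
    if "e \<in> E" "f \<in> E" "e \<noteq> f" for e f y
    using that orthonormal_cinner[OF E, of e f] by (auto simp: cinner_scaleC_left cinner_scaleC_right)
  have bound: "(\<Sum>e\<in>F. (norm (cinner (T e) y *\<^sub>C e))\<^sup>2) \<le> (K * norm y)\<^sup>2"
    if "finite F" "F \<subseteq> E" for F y
  proof -
    have "(\<Sum>e\<in>F. (norm (cinner (T e) y *\<^sub>C e))\<^sup>2) = (\<Sum>e\<in>F. (cmod (cinner (T e) y))\<^sup>2)"
      by (intro sum.cong refl) (use that orthonormal_norm[OF E] in \<open>auto simp: norm_scaleC\<close>)
    thus ?thesis using bessel_op[OF E that T K(2), of y] K by auto
  qed
  note infs = bounded_clinear_infsum[where W = "\<lambda>e y. cinner (T e) y *\<^sub>C e" and I = E and K = K,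
      OF orth bound]
  show summ: "(\<lambda>e. cinner (T e) y *\<^sub>C e) summable_on E" for y
    using infs(1) K by (auto simp: cinner_add_right cinner_scaleC_right scaleC_add_left scaleC_scaleC)
  show "bounded_clinear (\<lambda>y. \<Sum>\<^sub>\<infinity>e\<in>E. cinner (T e) y *\<^sub>C e)"
    using infs(2) K by (auto simp: cinner_add_right cinner_scaleC_right scaleC_add_left scaleC_scaleC)
  fix e y assume e: "e \<in> E"
  have "((\<lambda>f. cinner e (cinner (T f) y *\<^sub>C f)) has_sum
      cinner e (\<Sum>\<^sub>\<infinity>e\<in>E. cinner (T e) y *\<^sub>C e)) E"
    by (rule has_sum_bounded_linear[OF bounded_linear_cinner_right]) (simp add: summ)
  moreover have "((\<lambda>f. cinner e (cinner (T f) y *\<^sub>C f)) has_sum cinner (T e) y) E"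
    by (rule has_sum_finite_neutralI[of "{e}"])
       (use e orthonormal_cinner[OF E] in \<open>auto simp: cinner_scaleC_right\<close>)
  ultimately show "cinner e (\<Sum>\<^sub>\<infinity>e\<in>E. cinner (T e) y *\<^sub>C e) = cinner (T e) y"
    by (rule has_sum_unique)
qed

lemma onb_expansion:
  fixes E :: "'a::chilbert_space set"
  assumes "is_onb E"
  shows "((\<lambda>e. cinner e x *\<^sub>C e) has_sum x) E"
proof -
  note * = sum_coeff_orthonormal[OF is_onb_orthonormal[OF assms] bounded_clinear_id, unfolded id_apply]
  have "(\<Sum>\<^sub>\<infinity>e\<in>E. cinner e x *\<^sub>C e) = x"
    by (rule eq_if_cinner_eq_on_dense[OF is_onb_dense[OF assms]]) (rule *(3))
  thus ?thesis using *(1)[of x] by (metis has_sum_infsum)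
qed

lemma onb_cinner:
  fixes E :: "'a::chilbert_space set"
  assumes "is_onb E"
  shows "((\<lambda>e. cinner x e * cinner e y) has_sum cinner x y) E"
  using has_sum_bounded_linear[OF bounded_linear_cinner_right[of x] onb_expansion[OF assms, of y]]
  by (simp add: cinner_scaleC_right mult.commute)

lemma onb_norm:
  fixes E :: "'a::chilbert_space set"
  assumes "is_onb E"
  shows "((\<lambda>e. (cmod (cinner e x))\<^sup>2) has_sum (norm x)\<^sup>2) E"
proof -
  have "cinner x e * cinner e x = complex_of_real ((cmod (cinner e x))\<^sup>2)" for e
    by (metis cinner_commute complex_norm_square mult.commute)
  hence "((\<lambda>e. complex_of_real ((cmod (cinner e x))\<^sup>2)) has_sum complex_of_real ((norm x)\<^sup>2)) E"
    using onb_cinner[OF assms, of x x] by (simp add: cinner_self)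
  thus ?thesis using has_sum_of_real_iff by blast
qed

text \<open>The difference between x and its projection is orthogonal to E, hence 0, and the finite
  partial sums of the projection lie in the span. This turns maximality of an orthonormal set into
  completeness.\<close>

lemma is_onb_if_complement_trivial:
  fixes E :: "'a::chilbert_space set"
  assumes E: "orthonormal E" and triv: "\<And>x. (\<And>e. e \<in> E \<Longrightarrow> cinner e x = 0) \<Longrightarrow> x = 0"
  shows "is_onb E"
proof -
  note * = sum_coeff_orthonormal[OF E bounded_clinear_id, unfolded id_apply]
  have "x \<in> closure (cspan E)" for x
  proof -
    have "x - (\<Sum>\<^sub>\<infinity>e\<in>E. cinner e x *\<^sub>C e) = 0"
      by (rule triv) (simp add: cinner_diff_right *(3))
    hence "((\<lambda>e. cinner e x *\<^sub>C e) has_sum x) E" using *(1)[of x] by (metis has_sum_infsum eq_iff_diff_eq_0)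
    hence lim: "(sum (\<lambda>e. cinner e x *\<^sub>C e) \<longlongrightarrow> x) (finite_subsets_at_top E)"
      by (simp add: has_sum_def)
    show ?thesis
    proof (rule Lim_in_closed_set[OF closed_closure _ _ lim])
      show "\<forall>\<^sub>F F in finite_subsets_at_top E. (\<Sum>e\<in>F. cinner e x *\<^sub>C e) \<in> closure (cspan E)"
      proof (rule eventually_finite_subsets_at_top_weakI)
        fix F assume "finite F" "F \<subseteq> E"
        hence "(\<Sum>e\<in>F. cinner e x *\<^sub>C e) \<in> cspan E"
          by (intro complex_vector.span_sum complex_vector.span_scale complex_vector.span_base) auto
        thus "(\<Sum>e\<in>F. cinner e x *\<^sub>C e) \<in> closure (cspan E)" using closure_subset by blast
      qed
    qed simp
  qed
  thus ?thesis using E by (auto simp: is_onb_iff)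
qed

section \<open>Adjoints of bounded operators\<close>

text \<open>The adjoint is written down by its coefficients, <e, S y> = <T e, y>, in place of an
  appeal to the Riesz theorem; hence the basis of the domain among the assumptions.\<close>

lemma ex_adjoint:
  fixes T :: "'a::chilbert_space \<Rightarrow> 'b::complex_inner"
  assumes E: "is_onb (E :: 'a set)" and T: "bounded_clinear T"
  obtains S where "bounded_clinear S" "\<And>x y. cinner (S y) x = cinner y (T x)"
proof -
  define S where "S y = (\<Sum>\<^sub>\<infinity>e\<in>E. cinner (T e) y *\<^sub>C e)" for y
  note * = sum_coeff_orthonormal[OF is_onb_orthonormal[OF E] T, folded S_def]
  have "{x. cinner x (S y) = cinner (T x) y} = UNIV" for y
  proof (rule closed_subspace_UNIV[OF is_onb_dense[OF E]])
    show "closed {x. cinner x (S y) = cinner (T x) y}"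
      by (intro closed_Collect_eq linear_continuous_on bounded_linear_cinner_left
          bounded_linear_compose[OF bounded_linear_cinner_left bounded_clinear_bounded_linear[OF T]])
  qed (use * in \<open>auto simp: cinner_add_left cinner_scaleC_left bounded_clinear_zero[OF T]
      bounded_clinear_add[OF T] bounded_clinear_scaleC[OF T]\<close>)
  hence "cinner x (S y) = cinner (T x) y" for x y by auto
  hence "cinner (S y) x = cinner y (T x)" for x y by (metis cinner_commute)
  thus ?thesis using that *(2) by blast
qed

lemma cadjoint:
  fixes T :: "'a::chilbert_space \<Rightarrow> 'b::complex_inner"
  assumes "is_onb (E :: 'a set)" and "bounded_clinear T"
  shows "bounded_clinear (cadjoint T)" and "cinner (cadjoint T y) x = cinner y (T x)"
    and "cinner x (cadjoint T y) = cinner (T x) y"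
proof -
  obtain S where S: "bounded_clinear S" "\<And>x y. cinner (S y) x = cinner y (T x)"
    using ex_adjoint[OF assms] by blast
  have "cadjoint T = S" unfolding cadjoint_def
  proof (rule the_equality)
    fix S' assume S': "\<forall>x y. cinner (S' y) x = cinner y (T x)"
    have "cinner z (S' y) = cinner z (S y)" for z y by (metis S(2) S' cinner_commute)
    thus "S' = S" by (intro ext cinner_eqI)
  qed (use S in auto)
  thus "bounded_clinear (cadjoint T)" "cinner (cadjoint T y) x = cinner y (T x)"
    "cinner x (cadjoint T y) = cinner (T x) y"
    using S by (auto, metis cinner_commute)
qed

section \<open>Diagonalisation of states\<close>

lemma positive_op_bounded_clinear: "positive_op T \<Longrightarrow> bounded_clinear T"
  by (simp add: positive_op_def)

lemma positive_op_nonneg: "positive_op T \<Longrightarrow> inner x (T x) \<ge> 0"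
  by (auto simp: positive_op_def inner_eq_Re_cinner complex_nonneg_Reals_iff)

text \<open>Polarisation: the quadratic form is real at \<open>x + y\<close> and at \<open>x + iy\<close>.\<close>

lemma positive_op_hermitian:
  assumes T: "positive_op T"
  shows "cinner (T x) y = cinner x (T y)"
proof -
  note lin = bounded_clinear_add[OF positive_op_bounded_clinear[OF T]]
    bounded_clinear_scaleC[OF positive_op_bounded_clinear[OF T]]
  have im: "Im (cinner z (T z)) = 0" for z
    using T by (auto simp: positive_op_def complex_nonneg_Reals_iff)
  have "Im (cinner x (T y) + cinner y (T x)) = 0"
    using im[of "x + y"] im[of x] im[of y] by (simp add: lin cinner_add_left cinner_add_right)
  moreover have "Re (cinner x (T y) - cinner y (T x)) = 0"
    using im[of "x + \<i> *\<^sub>C y"] im[of x] im[of y]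
    by (simp add: lin cinner_add_left cinner_add_right cinner_scaleC_left cinner_scaleC_right)
  ultimately have "cinner x (T y) = cnj (cinner y (T x))" by (simp add: complex_eq_iff)
  thus ?thesis by (metis cinner_commute)
qed

text \<open>The operator inequality P^2 \<le> M P for 0 \<le> P \<le> M, obtained without a square
  root of P from positivity of the form at x - P x / M. The set V allows form bounds that are known
  on an invariant subspace.\<close>

lemma norm_sq_le_if_form_le:
  fixes P :: "'a::real_inner \<Rightarrow> 'a"
  assumes P: "linear P" "\<And>x y. inner (P x) y = inner x (P y)"
    and V: "x \<in> V" "P x \<in> V" "x - (1 / M) *\<^sub>R P x \<in> V"
    and nonneg: "\<And>y. y \<in> V \<Longrightarrow> inner y (P y) \<ge> 0"
    and le: "\<And>y. y \<in> V \<Longrightarrow> inner y (P y) \<le> M * (norm y)\<^sup>2" and "M > 0"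
  shows "(norm (P x))\<^sup>2 \<le> M * inner x (P x)"
proof -
  have "inner x (P (P x)) = (norm (P x))\<^sup>2"
    by (metis P(2) power2_norm_eq_inner)
  hence "inner (x - (1 / M) *\<^sub>R P x) (P (x - (1 / M) *\<^sub>R P x)) =
      inner x (P x) - 2 / M * (norm (P x))\<^sup>2 + 1 / M\<^sup>2 * inner (P x) (P (P x))"
    by (simp add: linear_diff[OF P(1)] linear_scale[OF P(1)] inner_diff_left inner_diff_right
        dot_square_norm power2_eq_square algebra_simps diff_divide_distrib add_divide_distrib)
  hence "0 \<le> inner x (P x) - 2 / M * (norm (P x))\<^sup>2 + 1 / M\<^sup>2 * inner (P x) (P (P x))"
    using nonneg[OF V(3)] by simp
  also have "\<dots> \<le> inner x (P x) - 2 / M * (norm (P x))\<^sup>2 + 1 / M\<^sup>2 * (M * (norm (P x))\<^sup>2)"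
    by (intro add_left_mono mult_left_mono le V) auto
  also have "\<dots> = inner x (P x) - (norm (P x))\<^sup>2 / M"
    using \<open>M > 0\<close> by (simp add: power2_eq_square)
  finally show ?thesis using \<open>M > 0\<close> by (simp add: field_simps)
qed

section \<open>Compactness of Hilbert-Schmidt operators\<close>

lemma compact_coeff_sums:
  fixes F :: "'a::complex_inner set"
  assumes "finite F"
  shows "compact {\<Sum>e\<in>F. c e *\<^sub>C e | c. \<forall>e\<in>F. cmod (c e) \<le> B}"
  using assms
proof (induction F)
  case (insert a F)
  have "{\<Sum>e\<in>insert a F. c e *\<^sub>C e | c. \<forall>e\<in>insert a F. cmod (c e) \<le> B} =
      {x + y | x y. x \<in> (\<lambda>c. c *\<^sub>C a) ` cball 0 B \<and>
        y \<in> {\<Sum>e\<in>F. c e *\<^sub>C e | c. \<forall>e\<in>F. cmod (c e) \<le> B}}" (is "?L = ?R")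
  proof (intro subset_antisym subsetI)
    fix z assume "z \<in> ?L"
    then obtain c where "z = (\<Sum>e\<in>insert a F. c e *\<^sub>C e)" "\<forall>e\<in>insert a F. cmod (c e) \<le> B" by blast
    hence "z = c a *\<^sub>C a + (\<Sum>e\<in>F. c e *\<^sub>C e)" "c a \<in> cball 0 B" "\<forall>e\<in>F. cmod (c e) \<le> B"
      using insert by auto
    thus "z \<in> ?R" by blast
  next
    fix z assume "z \<in> ?R"
    then obtain k c where *: "z = k *\<^sub>C a + (\<Sum>e\<in>F. c e *\<^sub>C e)" "cmod k \<le> B" "\<forall>e\<in>F. cmod (c e) \<le> B"
      by auto
    have "(\<Sum>e\<in>F. (c(a := k)) e *\<^sub>C e) = (\<Sum>e\<in>F. c e *\<^sub>C e)"
      by (intro sum.cong) (use insert in auto)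
    thus "z \<in> ?L" using * insert by (auto intro!: exI[of _ "c(a := k)"])
  qed
  moreover have "compact ((\<lambda>c. c *\<^sub>C a) ` cball 0 B)"
    by (intro compact_continuous_image linear_continuous_on bounded_linear_scaleC_left) simp
  ultimately show ?case using compact_sums[OF _ insert.IH] by simp
qed simp

text \<open>
  Expanding \<open>T x\<close> in the basis approximates \<open>T\<close> uniformly on the unit ball by operators of finite
  rank, so that the image of the unit ball is totally bounded.
\<close>

lemma hilbert_schmidt_compact:
  fixes T :: "'a::chilbert_space \<Rightarrow> 'a"
  assumes E: "is_onb E" and T: "bounded_clinear T" "\<And>x y. cinner (T x) y = cinner x (T y)"
    and hs: "(\<lambda>e. (norm (T e))\<^sup>2) summable_on E"
  shows "compact (closure (T ` cball 0 1))"
  unfolding compact_eq_totally_bounded complete_eq_closed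
proof (intro conjI closed_closure allI impI)
  fix \<epsilon> :: real assume "\<epsilon> > 0"
  obtain K where K: "K > 0" "\<And>x. norm (T x) \<le> K * norm x" using bounded_clinear_bound[OF T(1)] by blast
  \<comment> \<open>An error d from truncation and an error d from the net give closed balls of
    radius 2 d = \<epsilon> / 2; these survive the passage to the closure and fit into the open
    balls of radius \<epsilon>.\<close>
  define d where "d = \<epsilon> / 4"
  have d: "d > 0" "d\<^sup>2 > 0" using \<open>\<epsilon> > 0\<close> by (auto simp: d_def)
  obtain F where F: "finite F" "F \<subseteq> E"
    and tail: "dist (\<Sum>e\<in>F. (norm (T e))\<^sup>2) (\<Sum>\<^sub>\<infinity>e\<in>E. (norm (T e))\<^sup>2) \<le> d\<^sup>2"
    using infsum_finite_approximation[OF hs d(2)] by auto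
  let ?C = "{\<Sum>e\<in>F. c e *\<^sub>C e | c. \<forall>e\<in>F. cmod (c e) \<le> K}"
  \<comment> \<open>The truncations of T x have coefficients bounded by K, so they all lie in one
    compact set, which has a finite d-net.\<close>
  obtain k where k: "finite k" "?C \<subseteq> (\<Union>x\<in>k. ball x d)"
    using compact_coeff_sums[OF F(1), of K] d(1) unfolding compact_eq_totally_bounded by meson
  have approx: "\<exists>w\<in>?C. norm (T x - w) \<le> d" if x: "norm x \<le> 1" for x
  proof -
    \<comment> \<open>Since <e, T x> = <T e, x>, the coefficients are bounded by the norm of T e
      uniformly in x; the tail of the Hilbert-Schmidt sum then controls the truncation error on the
      whole unit ball.\<close>
    have coeff: "cmod (cinner e (T x)) \<le> norm (T e)" for e
      using norm_cinner_le[of "T e" x] x mult_left_mono[OF x, of "norm (T e)"] by (simp add: T(2))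
    have "cmod (cinner e (T x)) \<le> K" if "e \<in> F" for e
      using coeff[of e] K(2)[of e] that F orthonormal_norm[OF is_onb_orthonormal[OF E], of e] by auto
    hence C: "(\<Sum>e\<in>F. cinner e (T x) *\<^sub>C e) \<in> ?C"
      by (intro CollectI exI[of _ "\<lambda>e. cinner e (T x)"]) auto
    define z where "z = T x - (\<Sum>e\<in>F. cinner e (T x) *\<^sub>C e)"
    have z: "cinner e z = (if e \<in> F then 0 else cinner e (T x))" if "e \<in> E" for e
    proof -
      have "(\<Sum>f\<in>F. cinner f (T x) * cinner e f) = (\<Sum>f\<in>F. if f = e then cinner e (T x) else 0)"
        by (intro sum.cong refl)
           (use F that in \<open>auto simp: orthonormal_cinner[OF is_onb_orthonormal[OF E] that] subset_iff\<close>)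
      thus ?thesis using F by (simp add: z_def cinner_diff_right cinner_sum_right cinner_scaleC_right)
    qed
    have "(norm z)\<^sup>2 \<le> d\<^sup>2"
    proof (rule has_sum_le_finite_sums[OF onb_norm[OF E]])
      fix G assume G: "finite G" "G \<subseteq> E"
      have "(\<Sum>e\<in>G. (cmod (cinner e z))\<^sup>2) \<le> (\<Sum>e\<in>G - F. (norm (T e))\<^sup>2)"
      proof -
        have "(\<Sum>e\<in>G. (cmod (cinner e z))\<^sup>2) = (\<Sum>e\<in>G - F. (cmod (cinner e z))\<^sup>2)"
          by (intro sum.mono_neutral_right) (use G z in auto)
        also have "\<dots> \<le> (\<Sum>e\<in>G - F. (norm (T e))\<^sup>2)"
          by (intro sum_mono) (use G z coeff in \<open>auto intro!: power_mono\<close>)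
        finally show ?thesis .
      qed
      also have "\<dots> = (\<Sum>e\<in>G \<union> F. (norm (T e))\<^sup>2) - (\<Sum>e\<in>F. (norm (T e))\<^sup>2)"
        by (subst sum_diff[symmetric]) (use G F in \<open>auto intro!: sum.cong\<close>)
      also have "(\<Sum>e\<in>G \<union> F. (norm (T e))\<^sup>2) \<le> (\<Sum>\<^sub>\<infinity>e\<in>E. (norm (T e))\<^sup>2)"
        by (rule finite_sum_le_infsum[OF hs]) (use G F in auto)
      finally show "(\<Sum>e\<in>G. (cmod (cinner e z))\<^sup>2) \<le> d\<^sup>2" using tail unfolding dist_real_def by linarith
    qed
    hence "norm z \<le> d" using d by (metis power2_le_imp_le less_imp_le)
    thus ?thesis using C unfolding z_def by blast
  qed
  have "T ` cball 0 1 \<subseteq> (\<Union>x\<in>k. cball x (2 * d))"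
  proof
    fix y assume "y \<in> T ` cball 0 1"
    then obtain x where "norm x \<le> 1" "y = T x" by auto
    then obtain w where w: "w \<in> ?C" "norm (y - w) \<le> d" using approx[of x] by blast
    then obtain x where x: "x \<in> k" "w \<in> ball x d" using k by blast
    have "dist x y \<le> dist x w + dist w y" by (rule dist_triangle)
    moreover have "dist w y \<le> d" using w(2) by (simp add: dist_norm norm_minus_commute)
    moreover have "dist x w < d" using x(2) by simp
    ultimately have "y \<in> cball x (2 * d)" by simp
    thus "y \<in> (\<Union>x\<in>k. cball x (2 * d))" using x by blast
  qed
  hence "closure (T ` cball 0 1) \<subseteq> (\<Union>x\<in>k. cball x (2 * d))"
    by (rule closure_minimal) (use k in auto)
  also have "\<dots> \<subseteq> (\<Union>x\<in>k. ball x \<epsilon>)" using d by (force simp: d_def)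
  finally show "\<exists>k. finite k \<and> closure (T ` cball 0 1) \<subseteq> (\<Union>x\<in>k. ball x \<epsilon>)" using k(1) by blast
qed

section \<open>Eigenvectors and eigenbases of compact positive operators\<close>

text \<open>Rayleigh's principle: M is the supremum of the form over the unit vectors of V, and
  compactness turns a maximising sequence into an eigenvector. The invariant subspace V is a
  parameter because it will be the orthogonal complement of eigenvectors already found.\<close>

lemma ex_eigenvector:
  fixes T :: "'a::chilbert_space \<Rightarrow> 'a"
  assumes T: "positive_op T" and cpt: "compact (closure (T ` cball 0 1))"
    and V: "closed V" "\<And>x y. x \<in> V \<Longrightarrow> y \<in> V \<Longrightarrow> x + y \<in> V" "\<And>c x. x \<in> V \<Longrightarrow> c *\<^sub>C x \<in> V"
      "\<And>x. x \<in> V \<Longrightarrow> T x \<in> V" and x0: "x0 \<in> V" "x0 \<noteq> 0"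
  shows "\<exists>v\<in>V. norm v = 1 \<and> (\<exists>r. T v = complex_of_real r *\<^sub>C v)"
proof -
  note bT = positive_op_bounded_clinear[OF T]
  have VR: "r *\<^sub>R x \<in> V" if "x \<in> V" for r x using V(3) that by (simp add: scaleR_scaleC)
  have Vd: "x - y \<in> V" if "x \<in> V" "y \<in> V" for x y
    using V(2)[OF that(1) VR[OF that(2), of "-1"]] by simp
  have linT: "linear T" using bT by (simp add: bounded_clinear_def bounded_linear.linear)
  have sym: "inner (T x) y = inner x (T y)" for x y
    by (simp add: inner_eq_Re_cinner positive_op_hermitian[OF T])
  obtain K where K: "K > 0" "\<And>x. norm (T x) \<le> K * norm x" using bounded_clinear_bound[OF bT] by blast
  have qK: "inner x (T x) \<le> K * (norm x)\<^sup>2" for x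
  proof -
    have "inner x (T x) \<le> norm x * norm (T x)" by (rule norm_cauchy_schwarz)
    also have "\<dots> \<le> norm x * (K * norm x)" by (intro mult_left_mono K) auto
    finally show ?thesis by (simp add: power2_eq_square mult_ac)
  qed
  let ?v = "\<lambda>x. (1 / norm x) *\<^sub>R x"
  show ?thesis
  proof (cases "\<forall>x\<in>V. inner x (T x) = 0")
    \<comment> \<open>A vanishing form forces T x0 = 0, so the normalised x0 is an eigenvector for
      0. In the other case M > 0, which the division by M requires.\<close>
    case True
    have "(norm (T x0))\<^sup>2 \<le> K * inner x0 (T x0)"
      by (rule norm_sq_le_if_form_le[where V = V, OF linT sym x0(1) V(4)[OF x0(1)]
            Vd[OF x0(1) VR[OF V(4)[OF x0(1)]]] positive_op_nonneg[OF T] qK K(1)])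
    hence "T x0 = 0" using True x0 by simp
    hence "T (?v x0) = complex_of_real 0 *\<^sub>C ?v x0" by (simp add: linear_scale[OF linT])
    moreover have "norm (?v x0) = 1" using x0 by simp
    ultimately show ?thesis using VR[OF x0(1)] by blast
  next
    case False
    define Q where "Q = {inner x (T x) | x. x \<in> V \<and> norm x = 1}"
    define M where "M = Sup Q"
    have "y \<le> K" if y: "y \<in> Q" for y
    proof -
      obtain x where "y = inner x (T x)" "norm x = 1" using y by (auto simp: Q_def)
      thus ?thesis using qK[of x] by simp
    qed
    hence bdd: "bdd_above Q" by (rule bdd_aboveI)
    have qv: "inner (?v x) (T (?v x)) = inner x (T x) / (norm x)\<^sup>2" for x
      by (simp add: linear_scale[OF linT] power2_eq_square)
    have qM: "inner x (T x) \<le> M * (norm x)\<^sup>2" if "x \<in> V" for x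
    proof (cases "x = 0")
      case False
      hence "inner x (T x) / (norm x)\<^sup>2 \<in> Q" using VR[OF that] unfolding qv[symmetric]
        by (auto simp: Q_def intro!: exI[of _ "?v x"])
      hence "inner x (T x) / (norm x)\<^sup>2 \<le> M" unfolding M_def using bdd by (rule cSup_upper)
      thus ?thesis using False by (simp add: field_simps)
    qed (simp add: linear_0[OF linT])
    from False obtain x1 where x1: "x1 \<in> V" "inner x1 (T x1) > 0"
      using positive_op_nonneg[OF T] by (metis order_le_less)
    hence "x1 \<noteq> 0" by auto
    have "0 < M * (norm x1)\<^sup>2" using qM[OF x1(1)] x1(2) by linarith
    hence M: "M > 0" by (simp add: zero_less_mult_iff)
    have "inner (?v x1) (T (?v x1)) \<in> Q" using VR[OF x1(1)] \<open>x1 \<noteq> 0\<close>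
      by (auto simp: Q_def intro!: exI[of _ "?v x1"])
    hence "Q \<noteq> {}" by blast
    have "\<exists>x. x \<in> V \<and> norm x = 1 \<and> M - inverse (Suc n) < inner x (T x)" for n
    proof -
      have "M - inverse (Suc n) < Sup Q" by (simp add: M_def)
      thus ?thesis using less_cSupE[OF _ \<open>Q \<noteq> {}\<close>] by (fastforce simp: Q_def)
    qed
    then obtain X where X: "\<And>n. X n \<in> V" "\<And>n. norm (X n) = 1"
      "\<And>n. M - inverse (Suc n) < inner (X n) (T (X n))" by metis
    \<comment> \<open>On V the form of M - T lies between 0 and M |y|^2, so the same operator
      inequality holds for M - T; at near-maximisers its right-hand side is small, whence M X n - T
      (X n) tends to 0.\<close>
    have close: "(norm (M *\<^sub>R x - T x))\<^sup>2 \<le> M * (M * (norm x)\<^sup>2 - inner x (T x))" if x: "x \<in> V" for x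
    proof -
      have "(norm (M *\<^sub>R x - T x))\<^sup>2 \<le> M * inner x (M *\<^sub>R x - T x)"
      proof (rule norm_sq_le_if_form_le[where V = V])
        show "linear (\<lambda>x. M *\<^sub>R x - T x)" by (intro linear_compose_sub linT linear_scaleR)
        show "M *\<^sub>R x - T x \<in> V" "x - (1 / M) *\<^sub>R (M *\<^sub>R x - T x) \<in> V" "x \<in> V"
          by (intro Vd VR V(4) x)+
        fix y
        show "inner y (M *\<^sub>R y - T y) \<ge> 0" if "y \<in> V"
          using qM[OF that] by (simp add: inner_diff_right power2_norm_eq_inner)
        show "inner y (M *\<^sub>R y - T y) \<le> M * (norm y)\<^sup>2"
          using positive_op_nonneg[OF T, of y] by (simp add: inner_diff_right power2_norm_eq_inner)
      qed (simp_all add: M inner_diff_left inner_diff_right sym)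
      thus ?thesis by (simp add: inner_diff_right power2_norm_eq_inner)
    qed
    have "(\<lambda>n. norm (M *\<^sub>R X n - T (X n))) \<longlonglongrightarrow> 0"
    proof (rule tendsto_sandwich[OF _ _ tendsto_const])
      show "\<forall>\<^sub>F n in sequentially. norm (M *\<^sub>R X n - T (X n)) \<le> sqrt (M * inverse (Suc n))"
      proof (intro always_eventually allI real_le_rsqrt)
        fix n
        have "M * (M * (norm (X n))\<^sup>2 - inner (X n) (T (X n))) \<le> M * inverse (Suc n)"
          using X[of n] M by (intro mult_left_mono) auto
        thus "(norm (M *\<^sub>R X n - T (X n)))\<^sup>2 \<le> M * inverse (Suc n)" using close[OF X(1)[of n]] by linarith
      qed
      have "(\<lambda>n. sqrt (M * inverse (Suc n))) \<longlonglongrightarrow> sqrt (M * 0)"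
        by (intro tendsto_intros LIMSEQ_inverse_real_of_nat)
      thus "(\<lambda>n. sqrt (M * inverse (Suc n))) \<longlonglongrightarrow> 0" by simp
    qed auto
    hence lim0: "(\<lambda>n. M *\<^sub>R X n - T (X n)) \<longlonglongrightarrow> 0" by (rule tendsto_norm_zero_cancel)
    \<comment> \<open>T (X n) converges along a subsequence by compactness, and with it M X n; the
      limit has norm M > 0 and so is nonzero.\<close>
    have "\<forall>n. T (X n) \<in> closure (T ` cball 0 1)"
      by (intro allI subsetD[OF closure_subset] imageI) (simp add: X(2))
    then obtain w r where r: "strict_mono r" "((\<lambda>n. T (X n)) \<circ> r) \<longlonglongrightarrow> w"
      using cpt unfolding compact_def by metis
    have "(\<lambda>n. T (X (r n)) + (M *\<^sub>R X (r n) - T (X (r n)))) \<longlonglongrightarrow> w + 0"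
      using r LIMSEQ_subseq_LIMSEQ[OF lim0 r(1)] by (intro tendsto_add) (auto simp: o_def)
    hence MX: "(\<lambda>n. M *\<^sub>R X (r n)) \<longlonglongrightarrow> w" by simp
    have "w \<in> V" by (rule closed_sequentially[OF V(1) _ MX]) (use X VR in auto)
    have "norm w = M" using tendsto_norm[OF MX] X(2) M by (simp add: LIMSEQ_const_iff)
    have "(\<lambda>n. T (M *\<^sub>R X (r n))) \<longlonglongrightarrow> T w"
      by (rule bounded_linear.tendsto[OF bounded_clinear_bounded_linear[OF bT] MX])
    moreover have "(\<lambda>n. T (M *\<^sub>R X (r n))) \<longlonglongrightarrow> M *\<^sub>R w"
      using tendsto_scaleR[OF tendsto_const r(2), of M] by (simp add: linear_scale[OF linT] o_def)
    ultimately have "T w = M *\<^sub>R w" by (rule LIMSEQ_unique)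
    hence "T (?v w) = complex_of_real M *\<^sub>C ?v w"
      by (simp add: linear_scale[OF linT] scaleC_of_real)
    moreover have "norm (?v w) = 1" using \<open>norm w = M\<close> M by simp
    ultimately show ?thesis using VR[OF \<open>w \<in> V\<close>] by blast
  qed
qed

text \<open>The eigenvalue at a unit vector g is the value \<open>inner g (T g)\<close> of the form,
  so the basis alone carries the spectral data, and multiplicities are counted by distinct basis
  vectors.\<close>

definition eigenbasis :: "('a::chilbert_space \<Rightarrow> 'a) \<Rightarrow> 'a set \<Rightarrow> bool" where
  "eigenbasis T G \<longleftrightarrow> is_onb G \<and> (\<forall>g\<in>G. T g = complex_of_real (inner g (T g)) *\<^sub>C g)"

text \<open>Zorn's lemma for orthonormal sets of eigenvectors. The complement of a maximal one is
  invariant by hermiticity, so a nonzero vector there would yield one more eigenvector. A kernel of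
  arbitrary dimension is covered along with the positive eigenvalues.\<close>

lemma ex_eigenbasis:
  fixes T :: "'a::chilbert_space \<Rightarrow> 'a"
  assumes T: "positive_op T" and cpt: "compact (closure (T ` cball 0 1))"
  shows "\<exists>G. eigenbasis T G"
proof -
  define \<A> where "\<A> = {F. orthonormal F \<and> (\<forall>f\<in>F. \<exists>r. T f = complex_of_real r *\<^sub>C f)}"
  have "\<exists>M\<in>\<A>. \<forall>X\<in>\<A>. M \<subseteq> X \<longrightarrow> X = M"
  proof (rule subset_Zorn')
    fix C assume C: "subset.chain \<A> C"
    have orth: "cinner e f = 0" if ef: "e \<in> \<Union>C" "f \<in> \<Union>C" "e \<noteq> f" for e f
    proof -
      obtain X Y where XY: "e \<in> X" "X \<in> C" "f \<in> Y" "Y \<in> C" using ef(1,2) by blast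
      hence "X \<subseteq> Y \<or> Y \<subseteq> X" using C by (metis subset_chain_def)
      hence "e \<in> X \<and> f \<in> X \<or> e \<in> Y \<and> f \<in> Y" using XY by blast
      moreover have "orthonormal X" "orthonormal Y" using C XY by (auto simp: subset_chain_def \<A>_def)
      ultimately show ?thesis using ef(3) unfolding orthonormal_def by blast
    qed
    have eig: "norm e = 1 \<and> (\<exists>r. T e = complex_of_real r *\<^sub>C e)" if e: "e \<in> \<Union>C" for e
    proof -
      obtain X where "e \<in> X" "X \<in> C" using e by blast
      hence "e \<in> X" "X \<in> \<A>" using C by (auto simp: subset_chain_def)
      thus ?thesis by (auto simp: \<A>_def orthonormal_def)
    qed
    show "\<Union>C \<in> \<A>" unfolding \<A>_def orthonormal_def mem_Collect_eq
      by (intro conjI ballI impI orth) (use eig in simp_all)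
  qed
  then obtain F where F: "F \<in> \<A>" and max: "\<And>X. X \<in> \<A> \<Longrightarrow> F \<subseteq> X \<Longrightarrow> X = F" by blast
  hence oF: "orthonormal F" by (simp add: \<A>_def)
  define V where "V = {x. \<forall>f\<in>F. cinner f x = 0}"
  have "is_onb F"
  proof (rule is_onb_if_complement_trivial[OF oF], rule ccontr)
    fix x assume x: "\<And>f. f \<in> F \<Longrightarrow> cinner f x = 0" "x \<noteq> 0"
    have "\<exists>v\<in>V. norm v = 1 \<and> (\<exists>r. T v = complex_of_real r *\<^sub>C v)"
    proof (rule ex_eigenvector[OF T cpt _ _ _ _ _ x(2)])
      have "V = (\<Inter>f\<in>F. {x. cinner f x = 0})" by (auto simp: V_def)
      thus "closed V"
        by (auto intro!: closed_INT closed_Collect_eq linear_continuous_on bounded_linear_cinner_right)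
      fix y assume y: "y \<in> V"
      show "T y \<in> V" unfolding V_def
      proof (intro CollectI ballI)
        fix f assume f: "f \<in> F"
        then obtain r where r: "T f = complex_of_real r *\<^sub>C f" using F by (auto simp: \<A>_def)
        have "cinner f (T y) = cinner (T f) y" by (simp add: positive_op_hermitian[OF T])
        also have "\<dots> = 0" using y f r by (simp add: V_def cinner_scaleC_left)
        finally show "cinner f (T y) = 0" .
      qed
    qed (use x in \<open>auto simp: V_def cinner_add_right cinner_scaleC_right\<close>)
    then obtain v r where v: "v \<in> V" "norm v = 1" "T v = complex_of_real r *\<^sub>C v" by blast
    have "cinner v f = 0" if "f \<in> F" for f using v that 
      by (subst cinner_commute) (simp add: V_def)
    hence "insert v F \<in> \<A>" using F v by (auto simp: \<A>_def orthonormal_def V_def)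
    hence "v \<in> F" using max by blast
    hence "cinner v v = 0" using v by (simp add: V_def)
    thus False using v by auto
  qed
  moreover have "T f = complex_of_real (inner f (T f)) *\<^sub>C f" if f: "f \<in> F" for f
  proof -
    obtain r where r: "T f = complex_of_real r *\<^sub>C f" using F f by (auto simp: \<A>_def)
    hence "inner f (T f) = r" using orthonormal_norm[OF oF f]
      by (simp add: scaleC_of_real power2_norm_eq_inner[symmetric])
    thus ?thesis using r by simp
  qed
  ultimately show ?thesis unfolding eigenbasis_def by blast
qed

section \<open>Traces in an eigenbasis\<close>

lemma eigenbasis_onb: "eigenbasis T G \<Longrightarrow> is_onb G"
  by (simp add: eigenbasis_def)

lemma eigenbasis_eq: "eigenbasis T G \<Longrightarrow> g \<in> G \<Longrightarrow> T g = complex_of_real (inner g (T g)) *\<^sub>C g"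
  by (simp add: eigenbasis_def)

lemma eigenbasis_matrix_element:
  assumes G: "eigenbasis T G" and T: "bounded_clinear T" and X: "bounded_clinear X"
  shows "((\<lambda>g. complex_of_real (inner g (T g)) * (cinner e (X g) * cinner g e)) has_sum cinner e (X (T e))) G"
proof -
  have "bounded_linear (\<lambda>x. cinner e (X (T x)))"
    by (rule bounded_linear_compose[OF bounded_linear_cinner_right
          bounded_clinear_bounded_linear[OF bounded_clinear_comp[OF X T]]])
  from has_sum_bounded_linear[OF this onb_expansion[OF eigenbasis_onb[OF G], of e]]
  show ?thesis
  proof (rule has_sum_cong[THEN iffD1, rotated])
    fix g assume g: "g \<in> G"
    define w where "w = inner g (T g)"
    have "T g = complex_of_real w *\<^sub>C g" unfolding w_def by (rule eigenbasis_eq[OF G g])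
    hence "X (T (cinner g e *\<^sub>C g)) = (cinner g e * complex_of_real w) *\<^sub>C X g"
      by (simp add: bounded_clinear_scaleC[OF X] bounded_clinear_scaleC[OF T] scaleC_scaleC)
    hence "X (T (cinner g e *\<^sub>C g)) = (cinner g e * complex_of_real (inner g (T g))) *\<^sub>C X g"
      unfolding w_def .
    thus "cinner e (X (T (cinner g e *\<^sub>C g))) =
        complex_of_real (inner g (T g)) * (cinner e (X g) * cinner g e)"
      by (simp add: cinner_scaleC_right mult_ac)
  qed
qed

lemma cmod_cinner_commute: "cmod (cinner x y) = cmod (cinner y x)"
  by (metis cinner_commute complex_mod_cnj)

lemma two_mult_le_squares: "2 * (a * b) \<le> a\<^sup>2 + (b::real)\<^sup>2"
  using sum_squares_bound[of a b] by (simp add: mult_ac)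

text \<open>Tonelli for the nonnegative family w_g |<g, e>|^2: summing over g first gives <e, T e>,
  summing over e first gives w_g because g is a unit vector.\<close>

lemma eigenvalues_summable_on:
  fixes T :: "'a::chilbert_space \<Rightarrow> 'a"
  assumes T: "positive_op T" and E: "is_onb E" "(\<lambda>e. inner e (T e)) summable_on E"
    and G: "eigenbasis T G"
  shows "(\<lambda>g. inner g (T g)) summable_on G"
proof -
  let ?h = "\<lambda>(e, g). inner g (T g) * (cmod (cinner g e))\<^sup>2"
  have row: "((\<lambda>g. ?h (e, g)) has_sum inner e (T e)) G" for e
  proof -
    have eq: "complex_of_real (inner g (T g)) * (cinner e g * cinner g e) =
        complex_of_real (inner g (T g) * (cmod (cinner g e))\<^sup>2)" for g
      unfolding of_real_mult complex_norm_square using cinner_commute[of e g] by simp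
    have "((\<lambda>g. inner g (T g) * (cmod (cinner g e))\<^sup>2) has_sum Re (cinner e (T e))) G"
      using has_sum_Re[OF eigenbasis_matrix_element[OF G positive_op_bounded_clinear[OF T] bounded_clinear_id, of e]]
      unfolding id_apply eq Re_complex_of_real .
    thus ?thesis by (simp add: inner_eq_Re_cinner)
  qed
  have "?h summable_on E \<times> G"
    by (rule summable_on_SigmaI[OF row E(2)]) (auto simp: positive_op_nonneg[OF T])
  hence "(\<lambda>(g, e). inner g (T g) * (cmod (cinner g e))\<^sup>2) summable_on G \<times> E"
    by (subst (asm) summable_on_swap) simp
  hence "(\<lambda>g. \<Sum>\<^sub>\<infinity>e\<in>E. inner g (T g) * (cmod (cinner g e))\<^sup>2) summable_on G"
    by (rule summable_on_Sigma_banach)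
  moreover have "(\<Sum>\<^sub>\<infinity>e\<in>E. inner g (T g) * (cmod (cinner g e))\<^sup>2) = inner g (T g)" if g: "g \<in> G" for g
  proof (rule infsumI)
    have "((\<lambda>e. (cmod (cinner g e))\<^sup>2) has_sum 1) E"
      using onb_norm[OF E(1), of g] orthonormal_norm[OF is_onb_orthonormal[OF eigenbasis_onb[OF G]] g]
      by (simp add: cmod_cinner_commute[of g])
    from has_sum_cmult_right[OF this, of "inner g (T g)"]
    show "((\<lambda>e. inner g (T g) * (cmod (cinner g e))\<^sup>2) has_sum inner g (T g)) E" by simp
  qed
  ultimately show ?thesis by (simp cong: summable_on_cong)
qed

lemma weighted_summable_on:
  assumes w: "w summable_on G" "\<And>g. g \<in> G \<Longrightarrow> 0 \<le> w g"
    and u: "\<And>g. g \<in> G \<Longrightarrow> 0 \<le> u g" "\<And>g. g \<in> G \<Longrightarrow> u g \<le> (K::real)"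
  shows "(\<lambda>g. w g * u g) summable_on G"
proof (rule summable_on_comparison_test)
  show "(\<lambda>g. w g * K) summable_on G" using w(1) by (rule summable_on_cmult_left)
qed (use w u in \<open>auto intro!: mult_left_mono\<close>)

lemma eigenbasis_weighted_summable_on:
  assumes T: "positive_op T" and G: "eigenbasis T G" "(\<lambda>g. inner g (T g)) summable_on G"
    and X: "bounded_clinear X"
  shows "(\<lambda>g. inner g (T g) * (norm (X g))\<^sup>2) summable_on G"
proof -
  obtain K where K: "K > 0" "\<And>x. norm (X x) \<le> K * norm x" using bounded_clinear_bound[OF X] by blast
  show ?thesis
  proof (rule weighted_summable_on[OF G(2)])
    fix g assume "g \<in> G"
    hence "norm (X g) \<le> K"
      using K(2)[of g] orthonormal_norm[OF is_onb_orthonormal[OF eigenbasis_onb[OF G(1)]]] by simp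
    thus "(norm (X g))\<^sup>2 \<le> K\<^sup>2" by (simp add: power_mono)
  qed (auto simp: positive_op_nonneg[OF T])
qed

text \<open>Fubini for w_g <e, X g> <g, e>: summed over e it is the term of g in the eigenbasis,
  summed over g it is <e, X T e>. The family is dominated by w_g (|<e, X g>|^2 + |<e, g>|^2), whose
  sum over e is w_g (|X g|^2 + |g|^2).\<close>

lemma has_sum_trace:
  fixes T :: "'a::chilbert_space \<Rightarrow> 'a"
  assumes T: "positive_op T" and G: "eigenbasis T G" "(\<lambda>g. inner g (T g)) summable_on G"
    and X: "bounded_clinear X" and E: "is_onb E"
  shows "((\<lambda>g. complex_of_real (inner g (T g)) * cinner g (X g)) has_sum (\<Sum>\<^sub>\<infinity>e\<in>E. cinner e (X (T e)))) G"
    and "((\<lambda>e. cinner e (X (T e))) has_sum (\<Sum>\<^sub>\<infinity>g\<in>G. complex_of_real (inner g (T g)) * cinner g (X g))) E"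
proof -
  let ?w = "\<lambda>g. inner g (T g)"
  let ?f = "\<lambda>(g, e). complex_of_real (?w g) * (cinner e (X g) * cinner g e)"
  let ?h = "\<lambda>(g, e). ?w g * ((cmod (cinner e (X g)))\<^sup>2 + (cmod (cinner e g))\<^sup>2)"
  have normG: "norm g = 1" if "g \<in> G" for g
    by (rule orthonormal_norm[OF is_onb_orthonormal[OF eigenbasis_onb[OF G(1)]] that])
  have "?h summable_on G \<times> E"
  proof (rule summable_on_SigmaI)
    fix g assume "g \<in> G"
    show "((\<lambda>e. ?h (g, e)) has_sum (?w g * ((norm (X g))\<^sup>2 + (norm g)\<^sup>2))) E"
      unfolding prod.case by (intro has_sum_cmult_right has_sum_add onb_norm E)
  next
    show "(\<lambda>g. ?w g * ((norm (X g))\<^sup>2 + (norm g)\<^sup>2)) summable_on G"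
      unfolding distrib_left
      by (intro summable_on_add eigenbasis_weighted_summable_on[OF T G X]
          eigenbasis_weighted_summable_on[OF T G bounded_clinear_id, unfolded id_apply])
  qed (auto simp: positive_op_nonneg[OF T])
  hence "(\<lambda>z. norm (?f z)) summable_on G \<times> E"
  proof (rule summable_on_comparison_test)
    fix z :: "'a \<times> 'a" obtain g e where z: "z = (g, e)" by force
    have "cmod (cinner e (X g)) * cmod (cinner g e) \<le> (cmod (cinner e (X g)))\<^sup>2 + (cmod (cinner e g))\<^sup>2"
      using two_mult_le_squares[of "cmod (cinner e (X g))" "cmod (cinner e g)"]
        mult_nonneg_nonneg[OF norm_ge_zero norm_ge_zero, of "cinner e (X g)" "cinner e g"]
      unfolding cmod_cinner_commute[of g e] by linarith
    thus "norm (?f z) \<le> ?h z"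
      by (auto simp: z norm_mult positive_op_nonneg[OF T] intro!: mult_left_mono)
  qed auto
  hence summ: "?f summable_on G \<times> E" by (rule abs_summable_summable)
  define S where "S = infsum ?f (G \<times> E)"
  have S: "(?f has_sum S) (G \<times> E)" using summ by (simp add: S_def)
  have 1: "((\<lambda>g. complex_of_real (?w g) * cinner g (X g)) has_sum S) G"
  proof (rule has_sum_SigmaD[OF S])
    fix g assume "g \<in> G"
    show "((\<lambda>e. ?f (g, e)) has_sum complex_of_real (?w g) * cinner g (X g)) E"
      using has_sum_cmult_right[OF onb_cinner[OF E, of g "X g"], of "complex_of_real (?w g)"]
      by (simp add: mult_ac)
  qed
  have S': "((\<lambda>(e, g). ?f (g, e)) has_sum S) (E \<times> G)" using S by (subst (asm) has_sum_swap)
  have 2: "((\<lambda>e. cinner e (X (T e))) has_sum S) E"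
  proof (rule has_sum_SigmaD[OF S'])
    fix e assume "e \<in> E"
    show "((\<lambda>g. (\<lambda>(e, g). ?f (g, e)) (e, g)) has_sum cinner e (X (T e))) G"
      using eigenbasis_matrix_element[OF G(1) positive_op_bounded_clinear[OF T] X, of e] by simp
  qed
  from 1 2 show "((\<lambda>g. complex_of_real (?w g) * cinner g (X g)) has_sum (\<Sum>\<^sub>\<infinity>e\<in>E. cinner e (X (T e)))) G"
    "((\<lambda>e. cinner e (X (T e))) has_sum (\<Sum>\<^sub>\<infinity>g\<in>G. complex_of_real (?w g) * cinner g (X g))) E"
    by (metis infsumI)+
qed

lemma ctrace_comp:
  fixes T :: "'a::chilbert_space \<Rightarrow> 'a"
  assumes T: "positive_op T" and G: "eigenbasis T G" "(\<lambda>g. inner g (T g)) summable_on G"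
    and X: "bounded_clinear X"
  shows "((\<lambda>g. complex_of_real (inner g (T g)) * cinner g (X g)) has_sum ctrace (X \<circ> T)) G"
proof -
  have "is_onb (SOME E::'a set. is_onb E)" by (rule someI_ex) (use eigenbasis_onb[OF G(1)] in blast)
  from has_sum_trace(1)[OF T G X this] show ?thesis by (simp add: ctrace_def)
qed

text \<open>The standard deviation has the state on the right of the square, the error has it on the
  left. The two traces are conjugate term by term, so their real parts agree.\<close>

lemma ctrace_square:
  fixes T :: "'a::chilbert_space \<Rightarrow> 'a"
  assumes T: "positive_op T" and G: "eigenbasis T G" "(\<lambda>g. inner g (T g)) summable_on G"
    and X: "hermitian_op X"
  shows "((\<lambda>g. inner g (T g) * (norm (X g))\<^sup>2) has_sum Re (ctrace (X \<circ> X \<circ> T))) G"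
    and "((\<lambda>g. inner g (T g) * (norm (X g))\<^sup>2) has_sum Re (ctrace (T \<circ> (X \<circ> X)))) G"
proof -
  have bX: "bounded_clinear X" and sX: "cinner (X x) y = cinner x (X y)" for x y
    using X by (auto simp: hermitian_op_def)
  have bXX: "bounded_clinear (X \<circ> X)" using bounded_clinear_comp[OF bX bX] by (simp add: o_def)
  have "cinner g ((X \<circ> X) g) = complex_of_real ((norm (X g))\<^sup>2)" for g
    by (simp only: o_apply sX[symmetric] cinner_self)
  hence "((\<lambda>g. complex_of_real (inner g (T g) * (norm (X g))\<^sup>2)) has_sum ctrace (X \<circ> X \<circ> T)) G"
    using ctrace_comp[OF T G bXX] by (simp only: of_real_mult)
  from has_sum_Re[OF this]
  show 1: "((\<lambda>g. inner g (T g) * (norm (X g))\<^sup>2) has_sum Re (ctrace (X \<circ> X \<circ> T))) G" by simp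
  have "cinner e (T (X (X e))) = cnj (cinner e (X (X (T e))))" for e
    by (metis cinner_commute positive_op_hermitian[OF T] sX)
  hence "ctrace (T \<circ> (X \<circ> X)) = cnj (ctrace (X \<circ> X \<circ> T))"
    by (simp add: ctrace_def)
  thus "((\<lambda>g. inner g (T g) * (norm (X g))\<^sup>2) has_sum Re (ctrace (T \<circ> (X \<circ> X)))) G" using 1 by simp
qed

lemma quantum_state_eigenbasis:
  fixes \<rho> :: "'a::chilbert_space \<Rightarrow> 'a"
  assumes "quantum_state \<rho>"
  obtains G where "eigenbasis \<rho> G" "((\<lambda>g. inner g (\<rho> g)) has_sum 1) G"
proof -
  have \<rho>: "positive_op \<rho>" and tr: "ctrace \<rho> = 1" and tc: "trace_class \<rho>"
    using assms by (auto simp: quantum_state_def)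
  note b\<rho> = positive_op_bounded_clinear[OF \<rho>]
  define E :: "'a set" where "E = (SOME E. is_onb E)"
  have E: "is_onb E" unfolding E_def by (rule someI_ex) (use tc in \<open>auto simp: trace_class_def\<close>)
  have "(\<Sum>\<^sub>\<infinity>e\<in>E. cinner e (\<rho> e)) = 1" using tr by (simp add: ctrace_def E_def)
  \<comment> \<open>An infinite sum that does not converge has the value 0 by convention, so the
    value 1 guarantees convergence.\<close>
  hence "((\<lambda>e. cinner e (\<rho> e)) has_sum 1) E"
    using infsum_not_exists by (metis has_sum_infsum zero_neq_one)
  hence E1: "((\<lambda>e. inner e (\<rho> e)) has_sum 1) E"
    using has_sum_Re by (fastforce simp: inner_eq_Re_cinner)
  hence summE: "(\<lambda>e. inner e (\<rho> e)) summable_on E" by (rule has_sum_imp_summable)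
  obtain K where K: "K > 0" "\<And>x. norm (\<rho> x) \<le> K * norm x" using bounded_clinear_bound[OF b\<rho>] by blast
  \<comment> \<open>Positivity bounds the squared norm of \<rho> x by a multiple of <x, \<rho> x>,
    so the trace series dominates the Hilbert-Schmidt series.\<close>
  have "(norm (\<rho> x))\<^sup>2 \<le> K * inner x (\<rho> x)" for x
  proof (rule norm_sq_le_if_form_le[where V = UNIV])
    show "linear \<rho>" using b\<rho> by (simp add: bounded_clinear_def bounded_linear.linear)
    show "inner y (\<rho> y) \<le> K * (norm y)\<^sup>2" for y
    proof -
      have "inner y (\<rho> y) \<le> norm y * norm (\<rho> y)" by (rule norm_cauchy_schwarz)
      also have "\<dots> \<le> norm y * (K * norm y)" by (intro mult_left_mono K) auto
      finally show ?thesis by (simp add: power2_eq_square mult_ac)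
    qed
  qed (auto simp: K inner_eq_Re_cinner positive_op_hermitian[OF \<rho>] positive_op_nonneg[OF \<rho>, unfolded inner_eq_Re_cinner])
  hence "(\<lambda>e. (norm (\<rho> e))\<^sup>2) summable_on E"
    by (intro summable_on_comparison_test[OF summable_on_cmult_right[OF summE, of K]]) auto
  hence "compact (closure (\<rho> ` cball 0 1))"
    by (rule hilbert_schmidt_compact[OF E b\<rho> positive_op_hermitian[OF \<rho>]])
  then obtain G where G: "eigenbasis \<rho> G" using ex_eigenbasis[OF \<rho>] by blast
  have summ: "(\<lambda>g. inner g (\<rho> g)) summable_on G" by (rule eigenvalues_summable_on[OF \<rho> E summE G])
  have "((\<lambda>g. complex_of_real (inner g (\<rho> g)) * cinner g (id g)) has_sum ctrace \<rho>) G"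
    using ctrace_comp[OF \<rho> G summ bounded_clinear_id] by simp
  moreover have "complex_of_real (inner g (\<rho> g)) * cinner g (id g) = complex_of_real (inner g (\<rho> g))"
    if "g \<in> G" for g
    using orthonormal_norm[OF is_onb_orthonormal[OF eigenbasis_onb[OF G]] that] by (simp add: cinner_self)
  ultimately have "((\<lambda>g. complex_of_real (inner g (\<rho> g))) has_sum complex_of_real 1) G"
    unfolding tr of_real_1 by (rule has_sum_cong[THEN iffD1, rotated])
  hence "((\<lambda>g. inner g (\<rho> g)) has_sum 1) G" using has_sum_of_real_iff by blast
  thus ?thesis using G that by blast
qed

section \<open>Extreme eigenvalues of a state\<close>

text \<open>An eigenvector x is not orthogonal to every g, and <g, T x> computed in two ways equates
  the eigenvalue of x with that of such a g.\<close>

lemma real_eigenvalues_eq: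
  fixes T :: "'a::chilbert_space \<Rightarrow> 'a"
  assumes T: "positive_op T" and G: "eigenbasis T G"
  shows "{r. complex_of_real r \<in> eigenvalues T} = (\<lambda>g. inner g (T g)) ` G"
proof (intro subset_antisym subsetI)
  fix r assume "r \<in> {r. complex_of_real r \<in> eigenvalues T}"
  then obtain x where x: "x \<noteq> 0" "T x = complex_of_real r *\<^sub>C x" by (auto simp: eigenvalues_def)
  obtain g where g: "g \<in> G" "cinner g x \<noteq> 0"
    using eq_if_cinner_eq_on_dense[OF is_onb_dense[OF eigenbasis_onb[OF G]], of x 0] x(1) by auto
  define w where "w = inner g (T g)"
  have w: "T g = complex_of_real w *\<^sub>C g" unfolding w_def by (rule eigenbasis_eq[OF G g(1)])
  have "cinner g (T x) = cinner (T g) x" by (simp add: positive_op_hermitian[OF T])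
  hence "complex_of_real r * cinner g x = complex_of_real w * cinner g x"
    by (simp add: x(2) w cinner_scaleC_left cinner_scaleC_right)
  hence "r = w" using g(2) by simp
  thus "r \<in> (\<lambda>g. inner g (T g)) ` G" using g(1) by (simp add: w_def)
next
  fix r assume "r \<in> (\<lambda>g. inner g (T g)) ` G"
  then obtain g where g: "g \<in> G" "r = inner g (T g)" by blast
  have "T g = complex_of_real r *\<^sub>C g" unfolding g(2) by (rule eigenbasis_eq[OF G g(1)])
  moreover have "g \<noteq> 0"
    using orthonormal_norm[OF is_onb_orthonormal[OF eigenbasis_onb[OF G]] g(1)] by auto
  ultimately show "r \<in> {r. complex_of_real r \<in> eigenvalues T}" by (auto simp: eigenvalues_def)
qed

text \<open>Terms at least as large as a fixed positive term \<open>w g0\<close> are finite in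
  number, since n of them contribute at least n \<open>w g0\<close> to a finite sum; the maximum is
  attained among these. This gives the \<open>GREATEST\<close> in the largest eigenvalue its
  meaning.\<close>

lemma has_sum_attains_max:
  fixes w :: "'i \<Rightarrow> real"
  assumes w: "(w has_sum s) G" "\<And>g. g \<in> G \<Longrightarrow> 0 \<le> w g" and "s > 0"
  obtains m where "m \<in> G" "\<And>g. g \<in> G \<Longrightarrow> w g \<le> w m"
proof -
  have "\<exists>g\<in>G. w g > 0"
  proof (rule ccontr)
    assume "\<not> ?thesis"
    hence "w g = 0" if "g \<in> G" for g using w(2)[OF that] that by force
    hence "(w has_sum 0) G" by (rule has_sum_0)
    thus False using w(1) \<open>s > 0\<close> has_sum_unique by fastforce
  qed
  then obtain g0 where g0: "g0 \<in> G" "w g0 > 0" by blast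
  define H where "H = {g \<in> G. w g \<ge> w g0}"
  have "finite H"
  proof (rule ccontr)
    assume inf: "infinite H"
    obtain n where n: "s < real n * w g0" using g0(2) reals_Archimedean3 by blast
    obtain F where F: "finite F" "card F = n" "F \<subseteq> H" using infinite_arbitrarily_large[OF inf] by blast
    have "real n * w g0 = (\<Sum>g\<in>F. w g0)" using F by simp
    also have "\<dots> \<le> (\<Sum>g\<in>F. w g)" using F by (intro sum_mono) (auto simp: H_def)
    also have "\<dots> \<le> s" by (rule finite_sum_le_has_sum[OF w(1)]) (use F w(2) in \<open>auto simp: H_def\<close>)
    finally show False using n by simp
  qed
  moreover have "g0 \<in> H" using g0 by (simp add: H_def)
  ultimately have "Max (w ` H) \<in> w ` H" and le: "\<And>g. g \<in> H \<Longrightarrow> w g \<le> Max (w ` H)"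
    by (auto intro: Max_in)
  then obtain m where m: "m \<in> H" "w m = Max (w ` H)" by auto
  have "w g \<le> w m" if "g \<in> G" for g
    using le[of g] le[OF \<open>g0 \<in> H\<close>] that m by (cases "g \<in> H") (auto simp: H_def)
  thus ?thesis using m(1) that by (auto simp: H_def)
qed

lemma le_largest_eigenvalue:
  fixes T :: "'a::chilbert_space \<Rightarrow> 'a"
  assumes T: "positive_op T" and G: "eigenbasis T G" and sum: "((\<lambda>g. inner g (T g)) has_sum s) G" "s > 0"
    and g: "g \<in> G"
  shows "inner g (T g) \<le> largest_eigenvalue T"
proof -
  obtain m where m: "m \<in> G" "\<And>g. g \<in> G \<Longrightarrow> inner g (T g) \<le> inner m (T m)"
    using has_sum_attains_max[OF sum(1) positive_op_nonneg[OF T] sum(2)] by blast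
  have eig: "complex_of_real r \<in> eigenvalues T \<longleftrightarrow> r \<in> (\<lambda>g. inner g (T g)) ` G" for r
    using real_eigenvalues_eq[OF T G] by blast
  have "largest_eigenvalue T = inner m (T m)"
    unfolding largest_eigenvalue_def eig by (rule Greatest_equality) (use m in auto)
  thus ?thesis using m(2)[OF g] by simp
qed

text \<open>The resolvent at \<open>r < 0\<close> is diagonal with the entries \<open>1 / (w - r)\<close>, bounded by \<open>1 / (- r)\<close>.\<close>

lemma negative_not_in_spectrum:
  fixes T :: "'a::chilbert_space \<Rightarrow> 'a"
  assumes T: "positive_op T" and G: "eigenbasis T G" and r: "r < 0"
  shows "complex_of_real r \<notin> spectrum_op T"
proof -
  note bT = positive_op_bounded_clinear[OF T]
  have oG: "orthonormal G" by (rule is_onb_orthonormal[OF eigenbasis_onb[OF G]])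
  define w where "w g = inner g (T g)" for g
  have w0: "w g \<ge> 0" for g by (simp add: w_def positive_op_nonneg[OF T])
  have Tg: "T g = complex_of_real (w g) *\<^sub>C g" if "g \<in> G" for g
    unfolding w_def by (rule eigenbasis_eq[OF G that])
  define c where "c g = complex_of_real (1 / (w g - r))" for g
  have c: "cmod (c g) \<le> 1 / (- r)" for g
  proof -
    have "1 / (w g - r) \<le> 1 / (- r)" by (rule frac_le) (use w0[of g] r in auto)
    thus ?thesis unfolding c_def norm_of_real using w0[of g] r by (simp del: of_real_divide)
  qed
  have c1: "c g * complex_of_real (w g - r) = 1" for g
    using w0[of g] r by (simp add: c_def flip: of_real_mult)
  define R where "R y = (\<Sum>\<^sub>\<infinity>g\<in>G. (c g * cinner g y) *\<^sub>C g)" for y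
  have R: "bounded_clinear R"
    unfolding R_def
  proof (rule bounded_clinear_infsum(2)[where K = "1 / (- r)"])
    fix i j x assume "i \<in> G" "j \<in> G" "i \<noteq> j"
    thus "cinner ((c i * cinner i x) *\<^sub>C i) ((c j * cinner j x) *\<^sub>C j) = 0"
      by (simp add: orthonormal_cinner[OF oG] cinner_scaleC_left cinner_scaleC_right)
  next
    fix F x assume F: "finite F" "F \<subseteq> G"
    have "(\<Sum>g\<in>F. (norm ((c g * cinner g x) *\<^sub>C g))\<^sup>2) \<le> (\<Sum>g\<in>F. (1 / (- r))\<^sup>2 * (cmod (cinner g x))\<^sup>2)"
    proof (rule sum_mono)
      fix g assume "g \<in> F"
      hence "norm g = 1" using F orthonormal_norm[OF oG] by blast
      hence "(norm ((c g * cinner g x) *\<^sub>C g))\<^sup>2 = (cmod (c g))\<^sup>2 * (cmod (cinner g x))\<^sup>2"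
        by (simp add: norm_scaleC norm_mult power_mult_distrib)
      thus "(norm ((c g * cinner g x) *\<^sub>C g))\<^sup>2 \<le> (1 / (- r))\<^sup>2 * (cmod (cinner g x))\<^sup>2"
        using power_mono[OF c norm_ge_zero, of g 2] mult_right_mono by fastforce
    qed
    also have "\<dots> = (1 / (- r))\<^sup>2 * (\<Sum>g\<in>F. (cmod (cinner g x))\<^sup>2)" by (rule sum_distrib_left[symmetric])
    also have "\<dots> \<le> (1 / (- r))\<^sup>2 * (norm x)\<^sup>2"
      by (intro mult_left_mono bessel[OF oG F]) auto
    finally show "(\<Sum>g\<in>F. (norm ((c g * cinner g x) *\<^sub>C g))\<^sup>2) \<le> (1 / (- r) * norm x)\<^sup>2"
      by (simp only: power_mult_distrib)
  qed (use r in \<open>auto simp: cinner_add_right cinner_scaleC_right distrib_left scaleC_add_left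
        scaleC_scaleC mult_ac\<close>)
  have Rg: "R g = c g *\<^sub>C g" if g: "g \<in> G" for g
    unfolding R_def
  proof (rule infsumI, rule has_sum_finite_neutralI[of "{g}"])
    fix h assume "h \<in> G - {g}"
    thus "(c h * cinner h g) *\<^sub>C h = 0" using g by (simp add: orthonormal_cinner[OF oG])
  qed (use g in \<open>auto simp: orthonormal_cinner[OF oG]\<close>)
  let ?S = "\<lambda>x. T x - complex_of_real r *\<^sub>C x"
  have S: "bounded_clinear ?S" by (intro bounded_clinear_diff_op bT bounded_clinear_scaleC_op)
  have Sg: "?S g = complex_of_real (w g - r) *\<^sub>C g" if "g \<in> G" for g
    by (simp add: Tg[OF that] complex_vector.scale_left_diff_distrib)
  note dense = is_onb_dense[OF eigenbasis_onb[OF G]]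
  have "(\<lambda>x. R (?S x)) = id"
    by (rule bounded_clinear_eq_on_dense[OF bounded_clinear_comp[OF R S] bounded_clinear_id dense])
       (simp add: Sg bounded_clinear_scaleC[OF R] Rg scaleC_scaleC c1[unfolded mult.commute[of "c _"]] del: of_real_diff)
  moreover have "(\<lambda>x. ?S (R x)) = id"
  proof (rule bounded_clinear_eq_on_dense[OF bounded_clinear_comp[OF S R] bounded_clinear_id dense])
    fix g assume g: "g \<in> G"
    have "?S (R g) = c g *\<^sub>C ?S g" unfolding Rg[OF g] by (rule bounded_clinear_scaleC[OF S])
    thus "?S (R g) = id g" using c1[of g] by (simp add: Sg[OF g] scaleC_scaleC del: of_real_diff)
  qed
  ultimately show ?thesis using R by (auto simp: spectrum_op_def o_def)
qed

lemma eigenvalues_subset_spectrum: "eigenvalues T \<subseteq> spectrum_op T"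
proof
  fix c assume "c \<in> eigenvalues T"
  then obtain x where x: "x \<noteq> 0" "T x - c *\<^sub>C x = 0" by (auto simp: eigenvalues_def)
  show "c \<in> spectrum_op T" unfolding spectrum_op_def
  proof (intro CollectI notI, elim exE conjE)
    fix R assume R: "bounded_clinear R" "R \<circ> (\<lambda>x. T x - c *\<^sub>C x) = id"
    have "x = R (T x - c *\<^sub>C x)" using fun_cong[OF R(2), of x] by simp
    thus False using x bounded_clinear_zero[OF R(1)] by simp
  qed
qed

text \<open>In finite dimension the basis is finite and the minimum is taken over its eigenvalues.
  Otherwise the eigenvalues belong to the spectrum, so the infimum lies below them, and the spectrum
  has no negative real points, so the infimum is at least 0.\<close>

lemma smallest_eigenvalue_bounds:
  fixes T :: "'a::chilbert_space \<Rightarrow> 'a"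
  assumes T: "positive_op T" and G: "eigenbasis T G" and g: "g \<in> G"
  shows "0 \<le> smallest_eigenvalue T" and "smallest_eigenvalue T \<le> inner g (T g)"
proof -
  have eig: "complex_of_real r \<in> eigenvalues T \<longleftrightarrow> r \<in> (\<lambda>g. inner g (T g)) ` G" for r
    using real_eigenvalues_eq[OF T G] by blast
  have "0 \<le> smallest_eigenvalue T \<and> smallest_eigenvalue T \<le> inner g (T g)"
  proof (cases "\<exists>S::'a set. finite S \<and> cspan S = UNIV")
    case True
    then obtain S :: "'a set" where "finite S" "cspan S = UNIV" by blast
    hence fin: "finite G"
      using complex_vector.independent_span_bound[of S G]
        orthonormal_independent[OF is_onb_orthonormal[OF eigenbasis_onb[OF G]]] by auto
    have "smallest_eigenvalue T = (LEAST r. r \<in> (\<lambda>g. inner g (T g)) ` G)"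
      using True unfolding smallest_eigenvalue_def eig by (rule if_P)
    also have "\<dots> = Min ((\<lambda>g. inner g (T g)) ` G)"
      by (rule Least_equality) (use fin g in \<open>auto intro!: Min_in\<close>)
    finally have eq: "smallest_eigenvalue T = Min ((\<lambda>g. inner g (T g)) ` G)" .
    have "Min ((\<lambda>g. inner g (T g)) ` G) \<in> (\<lambda>g. inner g (T g)) ` G" using fin g by (intro Min_in) auto
    thus ?thesis unfolding eq using positive_op_nonneg[OF T] fin g by (auto intro!: Min_le)
  next
    case False
    let ?Sp = "{r. complex_of_real r \<in> spectrum_op T}"
    have eq: "smallest_eigenvalue T = Inf ?Sp"
      using False unfolding smallest_eigenvalue_def by (rule if_not_P)
    have in_Sp: "inner g (T g) \<in> ?Sp" using eig g eigenvalues_subset_spectrum[of T] by blast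
    have nonneg: "0 \<le> r" if "r \<in> ?Sp" for r
      using negative_not_in_spectrum[OF T G, of r] that by (meson linorder_not_less mem_Collect_eq)
    show ?thesis unfolding eq
      using in_Sp nonneg by (auto intro!: cInf_greatest cInf_lower bdd_belowI[where m = 0])
  qed
  thus "0 \<le> smallest_eigenvalue T" "smallest_eigenvalue T \<le> inner g (T g)" by auto
qed

section \<open>Tensor products of operators\<close>

context
  fixes t :: "'a::chilbert_space \<Rightarrow> 'b::chilbert_space \<Rightarrow> 'c::chilbert_space"
  assumes t: "is_tensor_product t"
begin

lemma tensor_add_left: "t (x + x') y = t x y + t x' y"
  and tensor_scaleC_left: "t (c *\<^sub>C x) y = c *\<^sub>C t x y"
  using t by (auto simp: is_tensor_product_def Vector_Spaces.linear_iff_module_hom module_hom_iff)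

lemma tensor_add_right: "t x (y + y') = t x y + t x y'"
  and tensor_scaleC_right: "t x (c *\<^sub>C y) = c *\<^sub>C t x y"
  using t by (auto simp: is_tensor_product_def Vector_Spaces.linear_iff_module_hom module_hom_iff)

lemma cinner_tensor: "cinner (t x y) (t x' y') = cinner x x' * cinner y y'"
  using t by (auto simp: is_tensor_product_def)

lemma tensor_dense: "closure (cspan {t x y | x y. True}) = UNIV"
  using t by (auto simp: is_tensor_product_def)

lemma norm_tensor: "norm (t x y) = norm x * norm y"
proof -
  have "complex_of_real ((norm (t x y))\<^sup>2) = complex_of_real ((norm x * norm y)\<^sup>2)"
    by (simp only: cinner_self[symmetric] cinner_tensor power_mult_distrib of_real_mult)
  hence "(norm (t x y))\<^sup>2 = (norm x * norm y)\<^sup>2" using of_real_eq_iff by blast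
  thus ?thesis by simp
qed

lemma bounded_clinear_tensor_right: "bounded_clinear (\<lambda>y. t x y)"
  by (rule bounded_clinear_intro[where K = "norm x"])
     (auto simp: tensor_add_right tensor_scaleC_right norm_tensor)

lemma bounded_clinear_tensor_left: "bounded_clinear (\<lambda>x. t x y)"
  by (rule bounded_clinear_intro[where K = "norm y"])
     (auto simp: tensor_add_left tensor_scaleC_left norm_tensor)

text \<open>Exchanging the factors reduces S \<otimes> 1 to the construction of 1 \<otimes>
  T.\<close>

lemma is_tensor_product_flip: "is_tensor_product (\<lambda>y x. t x y)"
proof -
  have "{t y x | x y. True} = {t x y | x y. True}" by blast
  thus ?thesis using t by (auto simp: is_tensor_product_def mult.commute)
qed

lemma closed_subspace_tensor_UNIV:
  assumes "closed V" "0 \<in> V" "\<And>x y. x \<in> V \<Longrightarrow> y \<in> V \<Longrightarrow> x + y \<in> V"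
    and "\<And>c x. x \<in> V \<Longrightarrow> c *\<^sub>C x \<in> V" and "\<And>x y. t x y \<in> V"
  shows "V = UNIV"
  by (rule closed_subspace_UNIV[OF tensor_dense]) (use assms in auto)

lemma tensor_eqI:
  assumes "bounded_clinear S" "bounded_clinear T" "\<And>x y. S (t x y) = T (t x y)"
  shows "S = T"
  by (rule bounded_clinear_eq_on_dense[OF assms(1,2) tensor_dense]) (use assms(3) in auto)

text \<open>Equal product vectors have inner product 1, which is a product of two Kronecker deltas.
  Injectivity lets sums over the set of product vectors be written as sums over pairs.\<close>

lemma inj_on_tensor:
  assumes E: "orthonormal E" and F: "orthonormal F"
  shows "inj_on (\<lambda>(e, f). t e f) (E \<times> F)"
proof (rule inj_onI, clarify)
  fix e f e' f' assume *: "e \<in> E" "f \<in> F" "e' \<in> E" "f' \<in> F" "t e f = t e' f'"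
  have "cinner (t e f) (t e' f') = 1"
    unfolding *(5)[symmetric] using * by (simp add: cinner_tensor orthonormal_cinner[OF E] orthonormal_cinner[OF F])
  hence "cinner e e' * cinner f f' = 1" by (simp add: cinner_tensor)
  thus "e = e' \<and> f = f'"
    using *(1-4) by (simp add: orthonormal_cinner[OF E] orthonormal_cinner[OF F] split: if_splits)
qed

text \<open>Completeness is proved one factor at a time, by continuity of t in each argument
  separately: for fixed e in E the second factor is extended from F to the whole space, then for
  fixed y the first from E.\<close>

lemma is_onb_tensor:
  assumes E: "is_onb E" and F: "is_onb F"
  shows "is_onb ((\<lambda>(e, f). t e f) ` (E \<times> F))" (is "is_onb ?G")
proof -
  note oE = is_onb_orthonormal[OF E] and oF = is_onb_orthonormal[OF F]
  have "orthonormal ?G"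
    unfolding orthonormal_def
  proof safe
    fix e f assume "e \<in> E" "f \<in> F"
    thus "norm (t e f) = 1" by (simp add: norm_tensor orthonormal_norm[OF oE] orthonormal_norm[OF oF])
  next
    fix e f e' f' assume "e \<in> E" "f \<in> F" "e' \<in> E" "f' \<in> F" "t e f \<noteq> t e' f'"
    thus "cinner (t e f) (t e' f') = 0"
      by (auto simp: cinner_tensor orthonormal_cinner[OF oE] orthonormal_cinner[OF oF])
  qed
  moreover have "closure (cspan ?G) = UNIV"
  proof (rule closed_subspace_tensor_UNIV)
    let ?V = "closure (cspan ?G)"
    show add: "x + y \<in> ?V" if "x \<in> ?V" "y \<in> ?V" for x y
    proof -
      obtain X Y where "\<And>n. X n \<in> cspan ?G" "X \<longlonglongrightarrow> x" "\<And>n. Y n \<in> cspan ?G" "Y \<longlonglongrightarrow> y"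
        using \<open>x \<in> ?V\<close> \<open>y \<in> ?V\<close> unfolding closure_sequential by metis
      hence "\<forall>n. X n + Y n \<in> cspan ?G" "(\<lambda>n. X n + Y n) \<longlonglongrightarrow> x + y"
        by (auto intro: tendsto_add complex_vector.span_add)
      thus ?thesis unfolding closure_sequential by (intro exI[of _ "\<lambda>n. X n + Y n"] conjI)
    qed
    show scale: "c *\<^sub>C x \<in> ?V" if "x \<in> ?V" for c x
    proof -
      obtain X where "\<And>n. X n \<in> cspan ?G" "X \<longlonglongrightarrow> x"
        using \<open>x \<in> ?V\<close> unfolding closure_sequential by metis
      hence "\<forall>n. c *\<^sub>C X n \<in> cspan ?G" "(\<lambda>n. c *\<^sub>C X n) \<longlonglongrightarrow> c *\<^sub>C x"
        by (auto intro: bounded_linear.tendsto[OF bounded_linear_scaleC_right] complex_vector.span_scale)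
      thus ?thesis unfolding closure_sequential by (intro exI[of _ "\<lambda>n. c *\<^sub>C X n"] conjI)
    qed
    show zero: "0 \<in> ?V" using closure_subset complex_vector.span_zero by blast
    have 1: "t e y \<in> ?V" if "e \<in> E" for e y
    proof -
      have "{y. t e y \<in> ?V} = UNIV"
      proof (rule closed_subspace_UNIV[OF is_onb_dense[OF F]])
        show "F \<subseteq> {y. t e y \<in> ?V}"
        proof
          fix f assume "f \<in> F"
          hence "t e f \<in> cspan ?G" using \<open>e \<in> E\<close> by (intro complex_vector.span_base) force
          thus "f \<in> {y. t e y \<in> ?V}" using closure_subset by blast
        qed
        have "closed ((\<lambda>y. t e y) -` ?V)"
          by (intro continuous_closed_vimage closed_closure
              linear_continuous_at bounded_clinear_bounded_linear bounded_clinear_tensor_right)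
        thus "closed {y. t e y \<in> ?V}" by (simp add: vimage_def)
      qed (use add scale zero in \<open>simp_all add: tensor_add_right tensor_scaleC_right
          bounded_clinear_zero[OF bounded_clinear_tensor_right]\<close>)
      thus ?thesis by blast
    qed
    show "t x y \<in> ?V" for x y
    proof -
      have "{x. t x y \<in> ?V} = UNIV"
      proof (rule closed_subspace_UNIV[OF is_onb_dense[OF E]])
        have "closed ((\<lambda>x. t x y) -` ?V)"
          by (intro continuous_closed_vimage closed_closure
              linear_continuous_at bounded_clinear_bounded_linear bounded_clinear_tensor_left)
        thus "closed {x. t x y \<in> ?V}" by (simp add: vimage_def)
      qed (use add scale zero 1 in \<open>auto simp: tensor_add_left tensor_scaleC_left
          bounded_clinear_zero[OF bounded_clinear_tensor_left]\<close>)
      thus ?thesis by blast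
    qed
  qed auto
  ultimately show ?thesis by (simp add: is_onb_iff)
qed

text \<open>
  The operator \<open>cadjoint (t e)\<close> is the slice \<open>\<langle>e| \<otimes> 1\<close>; expanding the first tensor factor in the
  basis \<open>E\<close> gives \<open>1 \<otimes> T = \<Sum> (|e\<rangle> \<otimes> 1) T (\<langle>e| \<otimes> 1)\<close>.
\<close>

lemma slice_bessel:
  assumes E: "orthonormal E" and F: "is_onb (F::'b set)" and H: "finite H" "H \<subseteq> E"
  shows "(\<Sum>e\<in>H. (norm (cadjoint (t e) z))\<^sup>2) \<le> (norm z)\<^sup>2"
proof -
  note adj = cadjoint[OF F bounded_clinear_tensor_right]
  define s where "s = (\<Sum>e\<in>H. (norm (cadjoint (t e) z))\<^sup>2)"
  define w where "w = (\<Sum>e\<in>H. t e (cadjoint (t e) z))"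
  have "(norm w)\<^sup>2 = (\<Sum>e\<in>H. (norm (t e (cadjoint (t e) z)))\<^sup>2)"
    unfolding w_def
  proof (rule norm_sum_orthogonal[OF H(1)])
    fix e e' assume "e \<in> H" "e' \<in> H" "e \<noteq> e'"
    hence "cinner e e' = 0" using H orthonormal_cinner[OF E, of e e'] by auto
    thus "cinner (t e (cadjoint (t e) z)) (t e' (cadjoint (t e') z)) = 0" by (simp add: cinner_tensor)
  qed
  also have "\<dots> = s" unfolding s_def
    by (intro sum.cong refl) (use H orthonormal_norm[OF E] in \<open>auto simp: norm_tensor\<close>)
  finally have w: "norm w = sqrt s" by (metis norm_ge_zero real_sqrt_unique)
  have "cinner z w = complex_of_real s"
    by (simp add: w_def s_def cinner_sum_right adj(2)[symmetric] cinner_self)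
  hence "\<bar>s\<bar> \<le> norm z * norm w" by (metis norm_cinner_le norm_of_real)
  hence "s \<le> norm z * sqrt s" by (simp add: w)
  thus ?thesis unfolding s_def[symmetric]
    by (rule le_square_if_le_mult_sqrt) (auto simp: s_def intro: sum_nonneg)
qed

lemma ex_tensor_op_right:
  assumes E: "is_onb (E::'a set)" and F: "is_onb (F::'b set)" and T: "bounded_clinear T"
  obtains W where "bounded_clinear W" "\<And>x y. W (t x y) = t x (T y)"
proof -
  note oE = is_onb_orthonormal[OF E] and adj = cadjoint[OF F bounded_clinear_tensor_right]
  obtain K where K: "K > 0" "\<And>x. norm (T x) \<le> K * norm x" using bounded_clinear_bound[OF T] by blast
  define W where "W z = (\<Sum>\<^sub>\<infinity>e\<in>E. t e (T (cadjoint (t e) z)))" for z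
  have "bounded_clinear W"
    unfolding W_def
  proof (rule bounded_clinear_infsum(2)[where K = K])
    fix e e' z assume "e \<in> E" "e' \<in> E" "e \<noteq> e'"
    thus "cinner (t e (T (cadjoint (t e) z))) (t e' (T (cadjoint (t e') z))) = 0"
      by (simp add: cinner_tensor orthonormal_cinner[OF oE])
  next
    fix H z assume H: "finite H" "H \<subseteq> E"
    have "(\<Sum>e\<in>H. (norm (t e (T (cadjoint (t e) z))))\<^sup>2) \<le> (\<Sum>e\<in>H. K\<^sup>2 * (norm (cadjoint (t e) z))\<^sup>2)"
    proof (rule sum_mono)
      fix e assume "e \<in> H"
      hence "norm e = 1" using H orthonormal_norm[OF oE] by blast
      hence "norm (t e (T (cadjoint (t e) z))) \<le> K * norm (cadjoint (t e) z)" by (simp add: norm_tensor K)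
      thus "(norm (t e (T (cadjoint (t e) z))))\<^sup>2 \<le> K\<^sup>2 * (norm (cadjoint (t e) z))\<^sup>2"
        by (metis norm_ge_zero power_mono power_mult_distrib)
    qed
    also have "\<dots> = K\<^sup>2 * (\<Sum>e\<in>H. (norm (cadjoint (t e) z))\<^sup>2)" by (rule sum_distrib_left[symmetric])
    also have "\<dots> \<le> K\<^sup>2 * (norm z)\<^sup>2" by (intro mult_left_mono slice_bessel[OF oE F H]) auto
    finally show "(\<Sum>e\<in>H. (norm (t e (T (cadjoint (t e) z))))\<^sup>2) \<le> (K * norm z)\<^sup>2"
      by (simp only: power_mult_distrib)
  qed (use K in \<open>simp_all add: bounded_clinear_add[OF adj(1)] bounded_clinear_scaleC[OF adj(1)]
      bounded_clinear_add[OF T] bounded_clinear_scaleC[OF T] tensor_add_right tensor_scaleC_right\<close>)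
  moreover have "W (t x y) = t x (T y)" for x y
    unfolding W_def
  proof (rule infsumI)
    have slice: "cadjoint (t e) (t x y) = cinner e x *\<^sub>C y" for e
    proof (rule cinner_eqI)
      fix y' show "cinner y' (cadjoint (t e) (t x y)) = cinner y' (cinner e x *\<^sub>C y)"
        by (simp add: adj(3) cinner_tensor cinner_scaleC_right)
    qed
    have "t (cinner e x *\<^sub>C e) (T y) = t e (T (cadjoint (t e) (t x y)))" for e
      by (simp add: slice bounded_clinear_scaleC[OF T] tensor_scaleC_left tensor_scaleC_right)
    thus "((\<lambda>e. t e (T (cadjoint (t e) (t x y)))) has_sum t x (T y)) E"
      using has_sum_bounded_linear[OF bounded_clinear_bounded_linear[OF bounded_clinear_tensor_left] onb_expansion[OF E, of x], of "T y"]
      by simp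
  qed
  ultimately show ?thesis using that by blast
qed

end

text \<open>S \<otimes> T arises as S \<otimes> 1 after 1 \<otimes> T; uniqueness by density
  identifies it with the operator described in the definition.\<close>

lemma tensor_op:
  fixes t :: "'a::chilbert_space \<Rightarrow> 'b::chilbert_space \<Rightarrow> 'c::chilbert_space"
  assumes t: "is_tensor_product t" and E: "is_onb (E::'a set)" and F: "is_onb (F::'b set)"
    and S: "bounded_clinear S" and T: "bounded_clinear T"
  shows "bounded_clinear (tensor_op t S T)" and "tensor_op t S T (t x y) = t (S x) (T y)"
proof -
  obtain W where W: "bounded_clinear W" "\<And>x y. W (t x y) = t x (T y)"
    using ex_tensor_op_right[OF t E F T] by blast
  obtain V where V: "bounded_clinear V" "\<And>y x. V (t x y) = t (S x) y"
    by (rule ex_tensor_op_right[OF is_tensor_product_flip[OF t] F E S]) (rule that)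
  have VW: "bounded_clinear (\<lambda>z. V (W z)) \<and> (\<forall>x y. V (W (t x y)) = t (S x) (T y))"
    using bounded_clinear_comp[OF V(1) W(1)] V(2) W(2) by simp
  have "tensor_op t S T = (\<lambda>z. V (W z))"
    unfolding tensor_op_def
  proof (rule the_equality)
    show "bounded_clinear (\<lambda>z. V (W z)) \<and> (\<forall>x y. V (W (t x y)) = t (S x) (T y))" by (rule VW)
    fix X assume X: "bounded_clinear X \<and> (\<forall>x y. X (t x y) = t (S x) (T y))"
    show "X = (\<lambda>z. V (W z))"
    proof (rule tensor_eqI[OF t conjunct1[OF X] conjunct1[OF VW]])
      fix x y show "X (t x y) = V (W (t x y))"
        using conjunct2[OF X] conjunct2[OF VW] by (metis (no_types))
    qed
  qed
  thus "bounded_clinear (tensor_op t S T)" "tensor_op t S T (t x y) = t (S x) (T y)"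
    using VW by auto
qed

text \<open>Two density arguments, one for each argument of the inner product, extend the identity
  from elementary tensors.\<close>

lemma hermitian_tensor_op:
  fixes t :: "'a::chilbert_space \<Rightarrow> 'b::chilbert_space \<Rightarrow> 'c::chilbert_space"
  assumes t: "is_tensor_product t" and E: "is_onb (E::'a set)" and F: "is_onb (F::'b set)"
    and S: "hermitian_op S" and T: "hermitian_op T"
  shows "hermitian_op (tensor_op t S T)"
proof -
  have bS: "bounded_clinear S" and bT: "bounded_clinear T"
    and s: "cinner (S x) x' = cinner x (S x')" "cinner (T y) y' = cinner y (T y')" for x x' y y'
    using S T by (auto simp: hermitian_op_def)
  define W where "W = tensor_op t S T"
  note bW = tensor_op(1)[OF t E F bS bT, folded W_def] and W = tensor_op(2)[OF t E F bS bT, folded W_def]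
  note lin = bounded_clinear_add[OF bW] bounded_clinear_scaleC[OF bW] bounded_clinear_zero[OF bW]
  have clW: "bounded_linear (\<lambda>z. cinner u (W z))" "bounded_linear (\<lambda>z. cinner (W z) u)" for u
    by (rule bounded_linear_compose[OF bounded_linear_cinner_right bounded_clinear_bounded_linear[OF bW]],
        rule bounded_linear_compose[OF bounded_linear_cinner_left bounded_clinear_bounded_linear[OF bW]])
  have "{w. cinner (W (t x y)) w = cinner (t x y) (W w)} = UNIV" for x y
  proof (rule closed_subspace_tensor_UNIV[OF t])
    show "closed {w. cinner (W (t x y)) w = cinner (t x y) (W w)}"
      by (intro closed_Collect_eq linear_continuous_on bounded_linear_cinner_right clW)
  qed (auto simp: W cinner_tensor[OF t] s lin cinner_add_right cinner_scaleC_right)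
  hence 1: "cinner (W (t x y)) w = cinner (t x y) (W w)" for x y w by blast
  have "{z. cinner (W z) w = cinner z (W w)} = UNIV" for w
  proof (rule closed_subspace_tensor_UNIV[OF t])
    show "closed {z. cinner (W z) w = cinner z (W w)}"
      by (intro closed_Collect_eq linear_continuous_on bounded_linear_cinner_left clW)
  qed (auto simp: 1 lin cinner_add_left cinner_scaleC_left)
  thus ?thesis using bW by (auto simp: hermitian_op_def W_def)
qed

section \<open>The product state and its eigenbasis\<close>

text \<open>Diagonality writes the form as the sum of w_g |<g, x>|^2. In this way positivity of a
  tensor product of states is read off from its eigenvalues.\<close>

lemma positive_op_if_diagonal:
  fixes T :: "'a::chilbert_space \<Rightarrow> 'a"
  assumes T: "hermitian_op T" and G: "is_onb G"
    and w: "\<And>g. g \<in> G \<Longrightarrow> T g = complex_of_real (w g) *\<^sub>C g" "\<And>g. g \<in> G \<Longrightarrow> 0 \<le> w g"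
  shows "positive_op T" and "eigenbasis T G" and "\<And>g. g \<in> G \<Longrightarrow> inner g (T g) = w g"
proof -
  show wg: "inner g (T g) = w g" if "g \<in> G" for g
    using w(1)[OF that] orthonormal_norm[OF is_onb_orthonormal[OF G] that]
    by (simp add: scaleC_of_real power2_norm_eq_inner[symmetric])
  thus "eigenbasis T G" using w(1) G by (simp add: eigenbasis_def)
  have "cinner x (T x) \<in> \<real>\<^sub>\<ge>\<^sub>0" for x
  proof -
    have "cinner x g * cinner g (T x) = complex_of_real (w g * (cmod (cinner g x))\<^sup>2)" if "g \<in> G" for g
    proof -
      have "cinner g (T x) = cinner (T g) x" using T by (simp add: hermitian_op_def)
      also have "\<dots> = complex_of_real (w g) * cinner g x" by (simp add: w(1)[OF that] cinner_scaleC_left)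
      finally show ?thesis
        unfolding of_real_mult complex_norm_square using cinner_commute[of x g] by (simp add: mult_ac)
    qed
    hence *: "((\<lambda>g. complex_of_real (w g * (cmod (cinner g x))\<^sup>2)) has_sum cinner x (T x)) G"
      by (rule has_sum_cong[THEN iffD1, OF _ onb_cinner[OF G]])
    have "Im (cinner x (T x)) = 0" 
      using has_sum_Im[OF *] by (intro has_sum_unique[OF _ has_sum_0_simp]) simp
    moreover have "Re (cinner x (T x)) \<ge> 0"
      by (rule has_sum_nonneg[OF has_sum_Re[OF *]]) (simp add: w(2))
    ultimately show ?thesis by (simp add: complex_nonneg_Reals_iff)
  qed
  thus "positive_op T" using T by (simp add: positive_op_def hermitian_op_def)
qed

lemma has_sum_product:
  fixes a :: "'i \<Rightarrow> real" and b :: "'j \<Rightarrow> real"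
  assumes a: "(a has_sum A) I" "\<And>i. i \<in> I \<Longrightarrow> 0 \<le> a i" and b: "(b has_sum B) J" "\<And>j. j \<in> J \<Longrightarrow> 0 \<le> b j"
  shows "((\<lambda>(i, j). a i * b j) has_sum A * B) (I \<times> J)"
proof -
  have row: "((\<lambda>j. (\<lambda>(i, j). a i * b j) (i, j)) has_sum a i * B) J" for i
    unfolding prod.case by (rule has_sum_cmult_right[OF b(1)])
  have col: "((\<lambda>i. a i * B) has_sum A * B) I" by (rule has_sum_cmult_left[OF a(1)])
  show ?thesis
    by (rule has_sum_SigmaI[OF row col])
       (rule summable_on_SigmaI[OF row has_sum_imp_summable[OF col]], use a b in auto)
qed

lemma eigenbasis_tensor:
  fixes t :: "'a::chilbert_space \<Rightarrow> 'b::chilbert_space \<Rightarrow> 'c::chilbert_space"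
  assumes t: "is_tensor_product t" and S: "positive_op S" and T: "positive_op T"
    and E: "eigenbasis S E" and F: "eigenbasis T F"
  defines "W \<equiv> tensor_op t S T" and "G \<equiv> (\<lambda>(e, f). t e f) ` (E \<times> F)"
  shows "positive_op W" and "eigenbasis W G"
    and "e \<in> E \<Longrightarrow> f \<in> F \<Longrightarrow> inner (t e f) (W (t e f)) = inner e (S e) * inner f (T f)"
proof -
  note onb = eigenbasis_onb[OF E] eigenbasis_onb[OF F]
  note bS = positive_op_bounded_clinear[OF S] and bT = positive_op_bounded_clinear[OF T]
  have hW: "hermitian_op W" unfolding W_def
    by (rule hermitian_tensor_op[OF t onb])
       (auto simp: hermitian_op_def bS bT positive_op_hermitian[OF S] positive_op_hermitian[OF T])
  have G: "is_onb G" unfolding G_def by (rule is_onb_tensor[OF t onb])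
  \<comment> \<open>The diagonal entries are required as a function of the vector, so the pair of
    factors is recovered from it by inverting the injective product map.\<close>
  define ef where "ef = inv_into (E \<times> F) (\<lambda>(e, f). t e f)"
  have ef: "ef (t e f) = (e, f)" if "e \<in> E" "f \<in> F" for e f
    using inv_into_f_f[OF inj_on_tensor[OF t onb[THEN is_onb_orthonormal]], of "(e, f)"] that
    by (simp add: ef_def)
  define w where "w g = inner (fst (ef g)) (S (fst (ef g))) * inner (snd (ef g)) (T (snd (ef g)))" for g
  have w: "W (t e f) = complex_of_real (w (t e f)) *\<^sub>C t e f" if "e \<in> E" "f \<in> F" for e f
  proof -
    have "W (t e f) = t (S e) (T f)" unfolding W_def by (rule tensor_op(2)[OF t onb bS bT])
    also have "\<dots> = t (complex_of_real (inner e (S e)) *\<^sub>C e) (complex_of_real (inner f (T f)) *\<^sub>C f)"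
      by (rule arg_cong2[OF eigenbasis_eq[OF E that(1)] eigenbasis_eq[OF F that(2)]])
    finally show ?thesis
      using that by (simp add: w_def ef tensor_scaleC_left[OF t] tensor_scaleC_right[OF t] scaleC_scaleC)
  qed
  have w0: "0 \<le> w g" for g by (simp add: w_def positive_op_nonneg[OF S] positive_op_nonneg[OF T])
  note * = positive_op_if_diagonal[OF hW G, of w, OF _ w0]
  have w': "W g = complex_of_real (w g) *\<^sub>C g" if "g \<in> G" for g using w that by (auto simp: G_def)
  show "positive_op W" "eigenbasis W G" using *(1,2) w' by auto
  show "inner (t e f) (W (t e f)) = inner e (S e) * inner f (T f)" if "e \<in> E" "f \<in> F"
    using *(3)[OF w', of "t e f"] that by (auto simp: G_def w_def ef)
qed

lemma has_sum_tensor_reindex: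
  fixes t :: "'a::chilbert_space \<Rightarrow> 'b::chilbert_space \<Rightarrow> 'c::chilbert_space"
  assumes "is_tensor_product t" "orthonormal E" "orthonormal F"
  shows "(\<phi> has_sum s) ((\<lambda>(e, f). t e f) ` (E \<times> F)) \<longleftrightarrow> ((\<lambda>(e, f). \<phi> (t e f)) has_sum s) (E \<times> F)"
  using has_sum_reindex[OF inj_on_tensor[OF assms], of \<phi> s] by (simp add: o_def case_prod_unfold)

section \<open>The improved Robertson inequality\<close>

lemma hermitian_op_bounded_clinear: "hermitian_op X \<Longrightarrow> bounded_clinear X"
  and hermitian_op_cinner: "hermitian_op X \<Longrightarrow> cinner (X x) y = cinner x (X y)"
  by (simp_all add: hermitian_op_def)

lemma has_sum_diff:
  fixes f g :: "'i \<Rightarrow> 'a::real_normed_vector"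
  assumes "(f has_sum a) I" "(g has_sum b) I"
  shows "((\<lambda>i. f i - g i) has_sum a - b) I"
  using has_sum_add[OF assms(1), of "\<lambda>i. - g i" "- b"] assms(2) by (simp add: has_sum_uminus)

lemma bounded_clinear_commutator:
  assumes "bounded_clinear X" "bounded_clinear Y"
  shows "bounded_clinear (commutator X Y)"
  unfolding commutator_def 
  by (rule bounded_clinear_diff_op[OF bounded_clinear_comp[OF assms] bounded_clinear_comp[OF assms(2,1)]])

text \<open>Minimising \<alpha> x + y / \<alpha> turns a family of arithmetic-geometric estimates
  into a Cauchy-Schwarz bound. If x or y is 0 the infimum need not be attained, and c \<le> 0
  follows from arbitrarily small right-hand sides.\<close>

lemma le_two_sqrt_mult_if_le_weighted:
  fixes c x y :: real
  assumes le: "\<And>\<alpha>. \<alpha> > 0 \<Longrightarrow> c \<le> \<alpha> * x + y / \<alpha>" and "x \<ge> 0" "y \<ge> 0"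
  shows "c \<le> 2 * (sqrt x * sqrt y)"
proof (cases "x = 0 \<or> y = 0")
  case False
  hence pos: "sqrt x > 0" "sqrt y > 0" using assms by auto
  \<comment> \<open>The minimiser \<alpha> = sqrt y / sqrt x makes the two terms equal.\<close>
  have "c \<le> sqrt y / sqrt x * x + y / (sqrt y / sqrt x)" by (rule le) (use pos in simp)
  also have "sqrt y / sqrt x * x = sqrt x * sqrt y"
    using pos \<open>x \<ge> 0\<close> by (simp add: field_simps)
  also have "y / (sqrt y / sqrt x) = sqrt x * sqrt y"
    using pos \<open>y \<ge> 0\<close> by (simp add: field_simps)
  finally show ?thesis by simp
next
  case True
  have "c \<le> 0 + e" if "e > 0" for e
  proof (cases "x = 0")
    case True
    \<comment> \<open>A large \<alpha> brings y / \<alpha> below e; the summand 1 keeps \<alpha>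
      positive when y = 0.\<close>
    have "c \<le> (y + 1) / e * x + y / ((y + 1) / e)" by (rule le) (use \<open>y \<ge> 0\<close> that in simp)
    also have "\<dots> = y / (y + 1) * e" using True by simp
    also have "\<dots> \<le> 1 * e" by (intro mult_right_mono) (use \<open>y \<ge> 0\<close> that in auto)
    finally show ?thesis by simp
  next
    case False
    hence "y = 0" "x > 0" using \<open>x = 0 \<or> y = 0\<close> \<open>x \<ge> 0\<close> by auto
    thus ?thesis using le[of "e / x"] that by simp
  qed
  hence "c \<le> 0" by (rule field_le_epsilon)
  thus ?thesis using True by auto
qed

text \<open>The quotient |u - v| / (u + v) is governed by the ratio of the smaller to the larger
  number, which is at least m / L; the two products compared in the proof express this bound without
  division.\<close>

lemma diff_le_ratio_mult_sum:
  fixes u v m L :: real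
  assumes "m \<le> u" "u \<le> L" "m \<le> v" "v \<le> L" "0 \<le> m" "m < L"
  shows "\<bar>u - v\<bar> \<le> (L - m) / (L + m) * (u + v)"
proof -
  have "m * u \<le> v * L" "m * v \<le> u * L" using assms by (auto intro!: mult_mono)
  hence "\<bar>u - v\<bar> * (L + m) \<le> (L - m) * (u + v)" by (auto simp: abs_if algebra_simps)
  thus ?thesis using assms by (simp add: field_simps)
qed

text \<open>Hermiticity makes |<h, X g>| symmetric in g and h, so either weight gives the same sum;
  together they give 2 x for the weight w_g + w_h.\<close>

lemma has_sum_matrix_squares:
  fixes X :: "'a::chilbert_space \<Rightarrow> 'a"
  assumes G: "is_onb G" and w: "\<And>g. g \<in> G \<Longrightarrow> 0 \<le> w g"
    and sum: "((\<lambda>g. w g * (norm (X g))\<^sup>2) has_sum x) G" and X: "hermitian_op X"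
  shows "((\<lambda>(g, h). w g * (cmod (cinner h (X g)))\<^sup>2) has_sum x) (G \<times> G)"
    and "((\<lambda>(g, h). w h * (cmod (cinner h (X g)))\<^sup>2) has_sum x) (G \<times> G)"
proof -
  have row: "((\<lambda>h. (\<lambda>(g, h). w g * (cmod (cinner h (X g)))\<^sup>2) (g, h)) has_sum w g * (norm (X g))\<^sup>2) G" for g
    unfolding prod.case by (rule has_sum_cmult_right[OF onb_norm[OF G]])
  show 1: "((\<lambda>(g, h). w g * (cmod (cinner h (X g)))\<^sup>2) has_sum x) (G \<times> G)"
    by (rule has_sum_SigmaI[OF row sum], rule summable_on_SigmaI[OF row has_sum_imp_summable[OF sum]])
       (use w in auto)
  have "cmod (cinner g (X h)) = cmod (cinner h (X g))" for g h
    by (metis cmod_cinner_commute hermitian_op_cinner[OF X])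
  with has_sum_swap[THEN iffD1, OF 1]
  show "((\<lambda>(g, h). w h * (cmod (cinner h (X g)))\<^sup>2) has_sum x) (G \<times> G)" by simp
qed

text \<open>
  In the eigenbasis, \<open>Tr([X, Y] T) = \<Sum> (w\<^sub>g - w\<^sub>h) X\<^sub>g\<^sub>h Y\<^sub>h\<^sub>g\<close>, where
  \<open>\<bar>w\<^sub>g - w\<^sub>h\<bar> \<le> (L - m) / (L + m) (w\<^sub>g + w\<^sub>h)\<close>; the Cauchy-Schwarz inequality for the weights
  \<open>w\<^sub>g + w\<^sub>h\<close> is applied in the form of the arithmetic-geometric mean inequality with a parameter \<open>\<alpha>\<close>.
\<close>

lemma cmod_ctrace_commutator_le:
  fixes T :: "'a::chilbert_space \<Rightarrow> 'a"
  assumes T: "positive_op T" and G: "eigenbasis T G" and summ: "(\<lambda>g. inner g (T g)) summable_on G"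
    and bounds: "\<And>g. g \<in> G \<Longrightarrow> m \<le> inner g (T g)" "\<And>g. g \<in> G \<Longrightarrow> inner g (T g) \<le> L"
    and mL: "0 \<le> m" "m < L"
    and X: "hermitian_op X" and Y: "hermitian_op Y"
    and x: "((\<lambda>g. inner g (T g) * (norm (X g))\<^sup>2) has_sum x) G"
    and y: "((\<lambda>g. inner g (T g) * (norm (Y g))\<^sup>2) has_sum y) G"
  shows "cmod (ctrace (commutator X Y \<circ> T)) \<le> 2 * ((L - m) / (L + m)) * (sqrt x * sqrt y)"
proof -
  let ?w = "\<lambda>g. inner g (T g)" and ?C = "(L - m) / (L + m)"
  have w0: "0 \<le> ?w g" for g by (rule positive_op_nonneg[OF T])
  have C0: "0 \<le> ?C" using mL by simp
  note onb = eigenbasis_onb[OF G]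
  note bX = hermitian_op_bounded_clinear[OF X] and bY = hermitian_op_bounded_clinear[OF Y]
  note sX = hermitian_op_cinner[OF X] and sY = hermitian_op_cinner[OF Y]
  note xs = has_sum_matrix_squares[OF onb w0 x X] and ys = has_sum_matrix_squares[OF onb w0 y Y]
  define p where "p g h = cinner (X g) h * cinner h (Y g)" for g h
  define q where "q g h = cinner (Y g) h * cinner h (X g)" for g h
  have qp: "q h g = p g h" for g h by (simp add: p_def q_def sX sY mult.commute)
  have norm_p: "cmod (p g h) = cmod (cinner h (X g)) * cmod (cinner h (Y g))"
    and norm_q: "cmod (q g h) = cmod (cinner h (X g)) * cmod (cinner h (Y g))" for g h
    by (simp_all add: p_def q_def norm_mult cmod_cinner_commute[of _ h] mult.commute)
  have young: "a * b \<le> \<alpha> / 2 * a\<^sup>2 + 1 / (2 * \<alpha>) * b\<^sup>2" if "\<alpha> > 0" for a b \<alpha> :: real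
  proof -
    have "0 \<le> (\<alpha> * a - b)\<^sup>2 / (2 * \<alpha>)" using that by simp
    also have "\<dots> = \<alpha> / 2 * a\<^sup>2 + 1 / (2 * \<alpha>) * b\<^sup>2 - a * b"
      using that by (simp add: power2_eq_square field_simps)
    finally show ?thesis by simp
  qed
  \<comment> \<open>The series for XY and YX must each converge as a double series before the
    indices of one of them are exchanged.\<close>
  have summable: "(\<lambda>(g, h). complex_of_real (?w g) * f g h) summable_on G \<times> G"
    if f: "\<And>g h. cmod (f g h) = cmod (cinner h (X g)) * cmod (cinner h (Y g))" for f
  proof (rule abs_summable_summable, rule Infinite_Sum.abs_summable_on_comparison_test')
    show "(\<lambda>z. (\<lambda>(g, h). ?w g * (cmod (cinner h (X g)))\<^sup>2) z + (\<lambda>(g, h). ?w g * (cmod (cinner h (Y g)))\<^sup>2) z)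
        summable_on G \<times> G"
      by (rule summable_on_add[OF has_sum_imp_summable[OF xs(1)] has_sum_imp_summable[OF ys(1)]])
    fix z :: "'a \<times> 'a" obtain g h where z: "z = (g, h)" by force
    have "cmod (cinner h (X g)) * cmod (cinner h (Y g)) \<le>
        (cmod (cinner h (X g)))\<^sup>2 + (cmod (cinner h (Y g)))\<^sup>2"
      using young[of 1 "cmod (cinner h (X g))" "cmod (cinner h (Y g))"]
        zero_le_power2[of "cmod (cinner h (X g))"] zero_le_power2[of "cmod (cinner h (Y g))"] by linarith
    from mult_left_mono[OF this w0[of g]]
    show "norm ((\<lambda>(g, h). complex_of_real (?w g) * f g h) z) \<le> (\<lambda>(g, h). ?w g * (cmod (cinner h (X g)))\<^sup>2) z +
        (\<lambda>(g, h). ?w g * (cmod (cinner h (Y g)))\<^sup>2) z"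
      by (simp add: z norm_mult f w0 distrib_left)
  qed
  define P where "P = infsum (\<lambda>(g, h). complex_of_real (?w g) * p g h) (G \<times> G)"
  define Q where "Q = infsum (\<lambda>(g, h). complex_of_real (?w g) * q g h) (G \<times> G)"
  have P: "((\<lambda>(g, h). complex_of_real (?w g) * p g h) has_sum P) (G \<times> G)"
    unfolding P_def by (rule has_sum_infsum[OF summable[OF norm_p]])
  have Q: "((\<lambda>(g, h). complex_of_real (?w g) * q g h) has_sum Q) (G \<times> G)"
    unfolding Q_def by (rule has_sum_infsum[OF summable[OF norm_q]])
  \<comment> \<open>Exchanging the indices in the series for YX moves its weight from g to h, since
    \<open>q h g\<close> is \<open>p g h\<close>; the difference of the two series then carries w_g
    - w_h.\<close>
  have Q': "((\<lambda>(g, h). complex_of_real (?w h) * p g h) has_sum Q) (G \<times> G)"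
    using has_sum_swap[THEN iffD1, OF Q] by (simp add: qp)
  have PG: "((\<lambda>g. complex_of_real (?w g) * cinner (X g) (Y g)) has_sum P) G"
    by (rule has_sum_SigmaD[OF P], unfold prod.case p_def)
       (rule has_sum_cmult_right[OF onb_cinner[OF onb]])
  have QG: "((\<lambda>g. complex_of_real (?w g) * cinner (Y g) (X g)) has_sum Q) G"
    by (rule has_sum_SigmaD[OF Q], unfold prod.case q_def)
       (rule has_sum_cmult_right[OF onb_cinner[OF onb]])
  have "((\<lambda>g. complex_of_real (?w g) * cinner g (commutator X Y g)) has_sum P - Q) G"
    using has_sum_diff[OF PG QG]
    by (simp add: commutator_def cinner_diff_right sX sY right_diff_distrib)
  hence D: "ctrace (commutator X Y \<circ> T) = P - Q"
    using ctrace_comp[OF T G summ bounded_clinear_commutator[OF bX bY]] has_sum_unique by blast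
  \<comment> \<open>Each of x and y enters twice, once with the weight w_g and once with w_h; this
    cancels the halves of the weighted mean inequality.\<close>
  have PQ: "cmod (P - Q) \<le> \<alpha> * (?C * x) + (?C * y) / \<alpha>" if \<alpha>: "\<alpha> > 0" for \<alpha>
  proof (rule norm_infsum_le)
    show "((\<lambda>z. (\<lambda>(g, h). complex_of_real (?w g) * p g h) z - (\<lambda>(g, h). complex_of_real (?w h) * p g h) z)
        has_sum P - Q) (G \<times> G)"
      by (rule has_sum_diff[OF P Q'])
    have "((\<lambda>z. ?C * \<alpha> / 2 * ((\<lambda>(g, h). ?w g * (cmod (cinner h (X g)))\<^sup>2) z + (\<lambda>(g, h). ?w h * (cmod (cinner h (X g)))\<^sup>2) z)
        + ?C / (2 * \<alpha>) * ((\<lambda>(g, h). ?w g * (cmod (cinner h (Y g)))\<^sup>2) z + (\<lambda>(g, h). ?w h * (cmod (cinner h (Y g)))\<^sup>2) z))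
        has_sum (?C * \<alpha> / 2 * (x + x) + ?C / (2 * \<alpha>) * (y + y))) (G \<times> G)"
      by (intro has_sum_add has_sum_cmult_right xs ys)
    also have "c * \<alpha> / 2 * (x + x) + c / (2 * \<alpha>) * (y + y) = \<alpha> * (c * x) + (c * y) / \<alpha>" for c
      using \<alpha> by (simp add: field_simps)
    finally show "((\<lambda>z. ?C * \<alpha> / 2 * ((\<lambda>(g, h). ?w g * (cmod (cinner h (X g)))\<^sup>2) z + (\<lambda>(g, h). ?w h * (cmod (cinner h (X g)))\<^sup>2) z)
        + ?C / (2 * \<alpha>) * ((\<lambda>(g, h). ?w g * (cmod (cinner h (Y g)))\<^sup>2) z + (\<lambda>(g, h). ?w h * (cmod (cinner h (Y g)))\<^sup>2) z))
        has_sum \<alpha> * (?C * x) + (?C * y) / \<alpha>) (G \<times> G)" .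
    fix z assume "z \<in> G \<times> G"
    then obtain g h where z: "z = (g, h)" "g \<in> G" "h \<in> G" by blast
    let ?a = "cmod (cinner h (X g))" and ?b = "cmod (cinner h (Y g))"
    have "norm (complex_of_real (?w g) * p g h - complex_of_real (?w h) * p g h) = \<bar>?w g - ?w h\<bar> * (?a * ?b)"
      unfolding left_diff_distrib[symmetric] of_real_diff[symmetric] norm_mult norm_of_real norm_p ..
    also have "\<dots> \<le> (?C * (?w g + ?w h)) * (\<alpha> / 2 * ?a\<^sup>2 + 1 / (2 * \<alpha>) * ?b\<^sup>2)"
      by (rule mult_mono[OF diff_le_ratio_mult_sum[OF bounds bounds mL] young[OF \<alpha>]])
         (intro z mult_nonneg_nonneg add_nonneg_nonneg C0 w0 norm_ge_zero)+
    also have "(c * (u + v)) * (\<alpha> / 2 * a + 1 / (2 * \<alpha>) * b) =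
        c * \<alpha> / 2 * (u * a + v * a) + c / (2 * \<alpha>) * (u * b + v * b)" for c u v a b
      using \<alpha> by (simp add: field_simps)
    finally show "norm ((\<lambda>(g, h). complex_of_real (?w g) * p g h) z - (\<lambda>(g, h). complex_of_real (?w h) * p g h) z)
        \<le> ?C * \<alpha> / 2 * ((\<lambda>(g, h). ?w g * (cmod (cinner h (X g)))\<^sup>2) z + (\<lambda>(g, h). ?w h * (cmod (cinner h (X g)))\<^sup>2) z)
        + ?C / (2 * \<alpha>) * ((\<lambda>(g, h). ?w g * (cmod (cinner h (Y g)))\<^sup>2) z + (\<lambda>(g, h). ?w h * (cmod (cinner h (Y g)))\<^sup>2) z)"
      by (simp only: z(1) prod.case)
  qed
  have "x \<ge> 0" "y \<ge> 0"
    using has_sum_nonneg[OF x] has_sum_nonneg[OF y] w0 by auto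
  \<comment> \<open>The constant is attached to both x and y, so that the optimisation over \<alpha>
    returns it as the product of two square roots.\<close>
  hence "cmod (P - Q) \<le> 2 * (sqrt (?C * x) * sqrt (?C * y))"
    by (intro le_two_sqrt_mult_if_le_weighted PQ mult_nonneg_nonneg C0)
  also have "\<dots> = 2 * ?C * (sqrt x * sqrt y)"
  proof -
    have "sqrt ?C * sqrt ?C = ?C" 
      by (rule trans[OF real_sqrt_mult_self abs_of_nonneg[OF C0]])
    hence "2 * (sqrt ?C * sqrt ?C) * (sqrt x * sqrt y) = 2 * ?C * (sqrt x * sqrt y)" by (simp only:)
    thus ?thesis by (simp only: real_sqrt_mult mult_ac)
  qed
  finally show ?thesis using D by simp
qed

text \<open>The left-hand side is minus the sum of the other three commutators of \<open>[N\<^sub>A + P\<^sub>A, N\<^sub>B + P\<^sub>B] = 0\<close>.\<close>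

lemma cmod_ctrace_commutator_le_if_sums_commute:
  fixes T :: "'a::chilbert_space \<Rightarrow> 'a"
  assumes T: "positive_op T" and G: "eigenbasis T G" and summ: "(\<lambda>g. inner g (T g)) summable_on G"
    and bounds: "\<And>g. g \<in> G \<Longrightarrow> m \<le> inner g (T g)" "\<And>g. g \<in> G \<Longrightarrow> inner g (T g) \<le> L"
    and mL: "0 \<le> m" "m < L"
    and herm: "hermitian_op N\<^sub>A" "hermitian_op N\<^sub>B" "hermitian_op P\<^sub>A" "hermitian_op P\<^sub>B"
    and comm: "\<And>z. commutator (\<lambda>z. N\<^sub>A z + P\<^sub>A z) (\<lambda>z. N\<^sub>B z + P\<^sub>B z) z = 0"
    and sums: "((\<lambda>g. inner g (T g) * (norm (N\<^sub>A g))\<^sup>2) has_sum n\<^sub>a) G"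
      "((\<lambda>g. inner g (T g) * (norm (N\<^sub>B g))\<^sup>2) has_sum n\<^sub>b) G"
      "((\<lambda>g. inner g (T g) * (norm (P\<^sub>A g))\<^sup>2) has_sum p\<^sub>a) G"
      "((\<lambda>g. inner g (T g) * (norm (P\<^sub>B g))\<^sup>2) has_sum p\<^sub>b) G"
  shows "cmod (ctrace (commutator P\<^sub>A P\<^sub>B \<circ> T)) \<le>
    2 * ((L - m) / (L + m)) * (sqrt n\<^sub>a * sqrt n\<^sub>b + sqrt n\<^sub>a * sqrt p\<^sub>b + sqrt p\<^sub>a * sqrt n\<^sub>b)"
proof -
  note b = herm[THEN hermitian_op_bounded_clinear]
  note key = cmod_ctrace_commutator_le[OF T G summ bounds mL]
  note tr = ctrace_comp[OF T G summ bounded_clinear_commutator]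
  have "commutator P\<^sub>A P\<^sub>B z + (commutator N\<^sub>A N\<^sub>B z + commutator N\<^sub>A P\<^sub>B z + commutator P\<^sub>A N\<^sub>B z) = 0" for z
    using comm[of z] b[THEN bounded_clinear_add] by (simp add: commutator_def algebra_simps)
  hence zero: "cinner g (commutator P\<^sub>A P\<^sub>B g) + (cinner g (commutator N\<^sub>A N\<^sub>B g) +
      cinner g (commutator N\<^sub>A P\<^sub>B g) + cinner g (commutator P\<^sub>A N\<^sub>B g)) = 0" for g
    by (simp only: cinner_add_right[symmetric] cinner_zero_right)
  have "((\<lambda>g. complex_of_real (inner g (T g)) * cinner g (commutator P\<^sub>A P\<^sub>B g) +
      (complex_of_real (inner g (T g)) * cinner g (commutator N\<^sub>A N\<^sub>B g) +
       complex_of_real (inner g (T g)) * cinner g (commutator N\<^sub>A P\<^sub>B g) +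
       complex_of_real (inner g (T g)) * cinner g (commutator P\<^sub>A N\<^sub>B g))) has_sum
      (ctrace (commutator P\<^sub>A P\<^sub>B \<circ> T) + (ctrace (commutator N\<^sub>A N\<^sub>B \<circ> T) +
       ctrace (commutator N\<^sub>A P\<^sub>B \<circ> T) + ctrace (commutator P\<^sub>A N\<^sub>B \<circ> T)))) G"
    by (intro has_sum_add tr b)
  hence "ctrace (commutator P\<^sub>A P\<^sub>B \<circ> T) + (ctrace (commutator N\<^sub>A N\<^sub>B \<circ> T) +
       ctrace (commutator N\<^sub>A P\<^sub>B \<circ> T) + ctrace (commutator P\<^sub>A N\<^sub>B \<circ> T)) = 0"
    unfolding distrib_left[symmetric] zero by (intro has_sum_unique[OF _ has_sum_0_simp]) simp
  hence "cmod (ctrace (commutator P\<^sub>A P\<^sub>B \<circ> T)) = cmod (ctrace (commutator N\<^sub>A N\<^sub>B \<circ> T) +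
       ctrace (commutator N\<^sub>A P\<^sub>B \<circ> T) + ctrace (commutator P\<^sub>A N\<^sub>B \<circ> T))"
    by (metis add_eq_0_iff norm_minus_cancel)
  also have "\<dots> \<le> cmod (ctrace (commutator N\<^sub>A N\<^sub>B \<circ> T)) +
       cmod (ctrace (commutator N\<^sub>A P\<^sub>B \<circ> T)) + cmod (ctrace (commutator P\<^sub>A N\<^sub>B \<circ> T))"
    by (meson add_mono norm_triangle_ineq order_refl order_trans)
  also have "\<dots> \<le> 2 * ((L - m) / (L + m)) * (sqrt n\<^sub>a * sqrt n\<^sub>b) + 2 * ((L - m) / (L + m)) * (sqrt n\<^sub>a * sqrt p\<^sub>b)
      + 2 * ((L - m) / (L + m)) * (sqrt p\<^sub>a * sqrt n\<^sub>b)"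
    by (intro add_mono key herm sums)
  finally show ?thesis by (simp only: distrib_left)
qed

section \<open>Noise operators\<close>

lemma hermitian_op_diff:
  assumes "hermitian_op X" "hermitian_op Y"
  shows "hermitian_op (\<lambda>z. X z - Y z)"
  using assms by (simp add: hermitian_op_def bounded_clinear_diff_op cinner_diff_left cinner_diff_right)

lemma hermitian_op_diff_scalar:
  assumes X: "hermitian_op X" and c: "cnj c = c"
  shows "hermitian_op (\<lambda>z. X z - c *\<^sub>C z)"
  by (rule hermitian_op_diff[OF X])
     (simp add: hermitian_op_def bounded_clinear_scaleC_op cinner_scaleC_left cinner_scaleC_right c)

lemma hermitian_op_conjugate:
  fixes U :: "'a::chilbert_space \<Rightarrow> 'a"
  assumes G: "is_onb (G :: 'a set)" and U: "bounded_clinear U" and X: "hermitian_op X"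
  shows "hermitian_op (\<lambda>z. cadjoint U (X (U z)))"
proof -
  note adj = cadjoint[OF G U]
  have "bounded_clinear (\<lambda>z. cadjoint U (X (U z)))"
    by (rule bounded_clinear_comp[OF adj(1) bounded_clinear_comp[OF hermitian_op_bounded_clinear[OF X] U]])
  thus ?thesis by (simp add: hermitian_op_def adj hermitian_op_cinner[OF X])
qed

lemma hermitian_op_id: "hermitian_op id"
  by (simp add: hermitian_op_def bounded_clinear_id)

text \<open>Reality of the mean is what makes X - <X> hermitian, so that the formulas for second
  moments apply to it.\<close>

lemma expectation_real:
  fixes \<rho> :: "'a::chilbert_space \<Rightarrow> 'a"
  assumes \<rho>: "positive_op \<rho>" and F: "eigenbasis \<rho> F" "(\<lambda>f. inner f (\<rho> f)) summable_on F"
    and X: "hermitian_op X"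
  shows "cnj (expectation \<rho> X) = expectation \<rho> X"
proof -
  have s: "((\<lambda>f. complex_of_real (inner f (\<rho> f)) * cinner f (X f)) has_sum expectation \<rho> X) F"
    unfolding expectation_def by (rule ctrace_comp[OF \<rho> F hermitian_op_bounded_clinear[OF X]])
  have "cnj (cinner f (X f)) = cinner f (X f)" for f
    by (metis cinner_commute hermitian_op_cinner[OF X])
  hence "((\<lambda>f. complex_of_real (inner f (\<rho> f)) * cinner f (X f)) has_sum cnj (expectation \<rho> X)) F"
    using has_sum_cnj_iff[THEN iffD2, OF s] by simp
  thus ?thesis using s by (rule has_sum_unique)
qed

lemma
  fixes \<rho> :: "'a::chilbert_space \<Rightarrow> 'a"
  assumes \<rho>: "positive_op \<rho>" and F: "eigenbasis \<rho> F" "(\<lambda>f. inner f (\<rho> f)) summable_on F"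
    and X: "hermitian_op X"
  shows has_sum_std_deviation:
      "((\<lambda>f. inner f (\<rho> f) * (norm (X f - expectation \<rho> X *\<^sub>C f))\<^sup>2) has_sum (std_deviation \<rho> X)\<^sup>2) F"
    and std_deviation_nonneg: "0 \<le> std_deviation \<rho> X"
proof -
  define D where "D = (\<lambda>x. X x - expectation \<rho> X *\<^sub>C x)"
  have "hermitian_op D" unfolding D_def
    by (rule hermitian_op_diff_scalar[OF X expectation_real[OF \<rho> F X]])
  note sumD = ctrace_square(1)[OF \<rho> F this]
  have "0 \<le> Re (ctrace (D \<circ> D \<circ> \<rho>))"
    by (rule has_sum_nonneg[OF sumD]) (simp add: positive_op_nonneg[OF \<rho>])
  moreover have "std_deviation \<rho> X = sqrt (Re (ctrace (D \<circ> D \<circ> \<rho>)))"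
    by (simp only: std_deviation_def D_def Let_def)
  ultimately show "((\<lambda>f. inner f (\<rho> f) * (norm (X f - expectation \<rho> X *\<^sub>C f))\<^sup>2) has_sum
      (std_deviation \<rho> X)\<^sup>2) F" "0 \<le> std_deviation \<rho> X"
    using sumD by (simp_all add: D_def)
qed

text \<open>Partial trace over the second factor, which carries a state.\<close>

lemma has_sum_tensor_marginal:
  fixes t :: "'a::chilbert_space \<Rightarrow> 'b::chilbert_space \<Rightarrow> 'c::chilbert_space"
    and \<phi> :: "'c \<Rightarrow> 'd::real_normed_vector"
  assumes t: "is_tensor_product t" and EF: "orthonormal E" "orthonormal F"
    and \<phi>: "(\<phi> has_sum s) ((\<lambda>(e, f). t e f) ` (E \<times> F))"
    and \<mu>: "(\<mu> has_sum 1) F" and eq: "\<And>e f. e \<in> E \<Longrightarrow> f \<in> F \<Longrightarrow> \<phi> (t e f) = \<mu> f *\<^sub>R \<psi> e"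
  shows "(\<psi> has_sum s) E"
proof -
  have "((\<lambda>(e, f). \<phi> (t e f)) has_sum s) (E \<times> F)"
    using \<phi> unfolding has_sum_tensor_reindex[OF t EF] .
  thus ?thesis
  proof (rule has_sum_SigmaD)
    fix e assume e: "e \<in> E"
    have "((\<lambda>f. \<mu> f *\<^sub>R \<psi> e) has_sum \<psi> e) F"
      using has_sum_bounded_linear[OF bounded_linear_scaleR_left \<mu>, of "\<psi> e"] by simp
    thus "((\<lambda>f. (\<lambda>(e, f). \<phi> (t e f)) (e, f)) has_sum \<psi> e) F"
      by (simp add: eq[OF e] cong: has_sum_cong)
  qed
qed

theorem mainTheorem5:
  fixes t :: "'a::chilbert_space \<Rightarrow> 'b::chilbert_space \<Rightarrow> 'c::chilbert_space"
    and \<rho> A B :: "'a \<Rightarrow> 'a"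
    and \<rho>\<^sub>a\<^sub>p\<^sub>p A\<^sub>a\<^sub>p\<^sub>p B\<^sub>a\<^sub>p\<^sub>p :: "'b \<Rightarrow> 'b"
    and U :: "'c \<Rightarrow> 'c"
    and l\<^sub>m\<^sub>a\<^sub>x l\<^sub>m\<^sub>i\<^sub>n \<mu>\<^sub>m\<^sub>a\<^sub>x \<mu>\<^sub>m\<^sub>i\<^sub>n :: real
  assumes "separable_space (euclidean :: 'a topology)"
    and "separable_space (euclidean :: 'b topology)"
    and "is_tensor_product t"
    and "quantum_state \<rho>" and "quantum_state \<rho>\<^sub>a\<^sub>p\<^sub>p"
    and "l\<^sub>m\<^sub>a\<^sub>x = largest_eigenvalue \<rho>" and "l\<^sub>m\<^sub>i\<^sub>n = smallest_eigenvalue \<rho>"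
    and "\<mu>\<^sub>m\<^sub>a\<^sub>x = largest_eigenvalue \<rho>\<^sub>a\<^sub>p\<^sub>p" and "\<mu>\<^sub>m\<^sub>i\<^sub>n = smallest_eigenvalue \<rho>\<^sub>a\<^sub>p\<^sub>p"
    and "l\<^sub>m\<^sub>a\<^sub>x * \<mu>\<^sub>m\<^sub>a\<^sub>x \<noteq> l\<^sub>m\<^sub>i\<^sub>n * \<mu>\<^sub>m\<^sub>i\<^sub>n"
    and "hermitian_op A" and "hermitian_op B"
    and "hermitian_op A\<^sub>a\<^sub>p\<^sub>p" and "hermitian_op B\<^sub>a\<^sub>p\<^sub>p"
    and "A\<^sub>a\<^sub>p\<^sub>p \<circ> B\<^sub>a\<^sub>p\<^sub>p = B\<^sub>a\<^sub>p\<^sub>p \<circ> A\<^sub>a\<^sub>p\<^sub>p"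
    and "unitary_op U"
  shows "measurement_error t \<rho> \<rho>\<^sub>a\<^sub>p\<^sub>p U A A\<^sub>a\<^sub>p\<^sub>p * measurement_error t \<rho> \<rho>\<^sub>a\<^sub>p\<^sub>p U B B\<^sub>a\<^sub>p\<^sub>p
       + measurement_error t \<rho> \<rho>\<^sub>a\<^sub>p\<^sub>p U A A\<^sub>a\<^sub>p\<^sub>p * std_deviation \<rho> B
       + std_deviation \<rho> A * measurement_error t \<rho> \<rho>\<^sub>a\<^sub>p\<^sub>p U B B\<^sub>a\<^sub>p\<^sub>p
     \<ge> (l\<^sub>m\<^sub>a\<^sub>x * \<mu>\<^sub>m\<^sub>a\<^sub>x + l\<^sub>m\<^sub>i\<^sub>n * \<mu>\<^sub>m\<^sub>i\<^sub>n) / (2 * (l\<^sub>m\<^sub>a\<^sub>x * \<mu>\<^sub>m\<^sub>a\<^sub>x - l\<^sub>m\<^sub>i\<^sub>n * \<mu>\<^sub>m\<^sub>i\<^sub>n))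
         * cmod (expectation \<rho> (commutator A B))"
proof -
  note t = assms(3) and A = assms(11) and B = assms(12)
  have \<rho>: "positive_op \<rho>" and \<rho>a: "positive_op \<rho>\<^sub>a\<^sub>p\<^sub>p"
    using assms(4,5) by (auto simp: quantum_state_def)
  obtain E where E: "eigenbasis \<rho> E" and sumE: "((\<lambda>e. inner e (\<rho> e)) has_sum 1) E"
    using quantum_state_eigenbasis[OF assms(4)] by blast
  obtain F where F: "eigenbasis \<rho>\<^sub>a\<^sub>p\<^sub>p F" and sumF: "((\<lambda>f. inner f (\<rho>\<^sub>a\<^sub>p\<^sub>p f)) has_sum 1) F"
    using quantum_state_eigenbasis[OF assms(5)] by blast
  note onb = eigenbasis_onb[OF E] eigenbasis_onb[OF F]
  note on = onb[THEN is_onb_orthonormal]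
  note summE = has_sum_imp_summable[OF sumE]
  define \<Omega> where "\<Omega> = tensor_op t \<rho> \<rho>\<^sub>a\<^sub>p\<^sub>p"
  define G where "G = (\<lambda>(e, f). t e f) ` (E \<times> F)"
  note ten = eigenbasis_tensor[OF t \<rho> \<rho>a E F, folded \<Omega>_def G_def]
  have G: "is_onb G" by (rule eigenbasis_onb[OF ten(2)])
  have "((\<lambda>(e, f). inner e (\<rho> e) * inner f (\<rho>\<^sub>a\<^sub>p\<^sub>p f)) has_sum 1 * 1) (E \<times> F)"
    by (rule has_sum_product[OF sumE positive_op_nonneg[OF \<rho>] sumF positive_op_nonneg[OF \<rho>a]])
  hence "((\<lambda>(e, f). inner (t e f) (\<Omega> (t e f))) has_sum 1 * 1) (E \<times> F)"
    by (rule has_sum_cong[THEN iffD1, rotated]) (auto simp: ten(3))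
  hence sumG: "((\<lambda>g. inner g (\<Omega> g)) has_sum 1 * 1) G"
    unfolding G_def has_sum_tensor_reindex[OF t on] .
  note summG = has_sum_imp_summable[OF sumG]

  define m L where "m = l\<^sub>m\<^sub>i\<^sub>n * \<mu>\<^sub>m\<^sub>i\<^sub>n" and "L = l\<^sub>m\<^sub>a\<^sub>x * \<mu>\<^sub>m\<^sub>a\<^sub>x"
  have bE: "0 \<le> l\<^sub>m\<^sub>i\<^sub>n" "l\<^sub>m\<^sub>i\<^sub>n \<le> inner e (\<rho> e)" "inner e (\<rho> e) \<le> l\<^sub>m\<^sub>a\<^sub>x" if "e \<in> E" for e
    using smallest_eigenvalue_bounds[OF \<rho> E that] le_largest_eigenvalue[OF \<rho> E sumE _ that] assms(6,7) by auto
  have bF: "0 \<le> \<mu>\<^sub>m\<^sub>i\<^sub>n" "\<mu>\<^sub>m\<^sub>i\<^sub>n \<le> inner f (\<rho>\<^sub>a\<^sub>p\<^sub>p f)" "inner f (\<rho>\<^sub>a\<^sub>p\<^sub>p f) \<le> \<mu>\<^sub>m\<^sub>a\<^sub>x" if "f \<in> F" for f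
    using smallest_eigenvalue_bounds[OF \<rho>a F that] le_largest_eigenvalue[OF \<rho>a F sumF _ that] assms(8,9) by auto
  have bounds: "m \<le> inner g (\<Omega> g)" "inner g (\<Omega> g) \<le> L" if "g \<in> G" for g
  proof -
    obtain e f where g: "g = t e f" "e \<in> E" "f \<in> F" using \<open>g \<in> G\<close> by (auto simp: G_def)
    show "m \<le> inner g (\<Omega> g)" unfolding g(1) ten(3)[OF g(2,3)] m_def
      by (rule mult_mono[OF bE(2)[OF g(2)] bF(2)[OF g(3)] positive_op_nonneg[OF \<rho>] bF(1)[OF g(3)]])
    have "0 \<le> l\<^sub>m\<^sub>a\<^sub>x" using bE[OF g(2)] by linarith
    thus "inner g (\<Omega> g) \<le> L" unfolding g(1) ten(3)[OF g(2,3)] L_def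
      by (rule mult_mono[OF bE(3)[OF g(2)] bF(3)[OF g(3)] _ positive_op_nonneg[OF \<rho>a]])
  qed
  \<comment> \<open>Some eigenvalue has to exist: it lies between m and L, and the assumption that
    the two products differ then makes m < L strict.\<close>
  have "G \<noteq> {}" using sumG has_sum_unique[OF has_sum_empty] by fastforce
  then obtain g0 where "g0 \<in> G" by blast
  then obtain e0 f0 where "e0 \<in> E" "f0 \<in> F" by (auto simp: G_def)
  have mL: "0 \<le> m" "m < L"
  proof -
    show "0 \<le> m" unfolding m_def using bE(1)[OF \<open>e0 \<in> E\<close>] bF(1)[OF \<open>f0 \<in> F\<close>] by simp
    show "m < L" using bounds[OF \<open>g0 \<in> G\<close>] assms(10) by (simp add: m_def L_def)
  qed

  \<comment> \<open>\<open>P X\<close> is X \<otimes> 1 minus its mean, and \<open>M X\<close> is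
    the meter after the interaction, in the Heisenberg picture.\<close>
  define P where "P X = (\<lambda>z. tensor_op t X id z - expectation \<rho> X *\<^sub>C z)" for X
  define M where "M X = (\<lambda>z. cadjoint U (tensor_op t id X (U z)))" for X
  have N: "noise_op t U X Xa = (\<lambda>z. M Xa z - tensor_op t X id z)" for X Xa
    by (simp add: noise_op_def M_def)
  have U: "bounded_clinear U" and UU: "U (cadjoint U z) = z" for z
    using assms(16) by (auto simp: unitary_op_def fun_eq_iff)
  have hX: "hermitian_op (tensor_op t X id)" if "hermitian_op X" for X
    by (rule hermitian_tensor_op[OF t onb that hermitian_op_id])
  have hM: "hermitian_op (M Xa)" if "hermitian_op Xa" for Xa
    unfolding M_def
    by (rule hermitian_op_conjugate[OF G U hermitian_tensor_op[OF t onb hermitian_op_id that]])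
  have hN: "hermitian_op (noise_op t U X Xa)" if "hermitian_op X" "hermitian_op Xa" for X Xa
    unfolding N by (rule hermitian_op_diff[OF hM[OF that(2)] hX[OF that(1)]])
  have hP: "hermitian_op (P X)" if "hermitian_op X" for X
    unfolding P_def by (rule hermitian_op_diff_scalar[OF hX[OF that] expectation_real[OF \<rho> E summE that]])
  have Pt: "P X (t e f) = t (X e - expectation \<rho> X *\<^sub>C e) f" if "hermitian_op X" for X e f
    unfolding P_def tensor_op(2)[OF t onb hermitian_op_bounded_clinear[OF that] bounded_clinear_id]
    by (simp add: bounded_clinear_diff[OF bounded_clinear_tensor_left[OF t]] tensor_scaleC_left[OF t])

  have err: "((\<lambda>g. inner g (\<Omega> g) * (norm (noise_op t U X Xa g))\<^sup>2) has_sum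
      Re (ctrace (\<Omega> \<circ> (noise_op t U X Xa \<circ> noise_op t U X Xa)))) G"
    if "hermitian_op X" "hermitian_op Xa" for X Xa
    by (rule ctrace_square(2)[OF ten(1,2) summG hN[OF that]])
  have dev: "((\<lambda>g. inner g (\<Omega> g) * (norm (P X g))\<^sup>2) has_sum (std_deviation \<rho> X)\<^sup>2) G"
    if X: "hermitian_op X" for X
  proof -
    have total: "((\<lambda>g. inner g (\<Omega> g) * (norm (P X g))\<^sup>2) has_sum Re (ctrace (P X \<circ> P X \<circ> \<Omega>))) G"
      by (rule ctrace_square(1)[OF ten(1,2) summG hP[OF X]])
    \<comment> \<open>On t e f the norm is that of the vector of the system, so summing over f
      leaves a series over E, and comparison with the series for the variance identifies the
      values.\<close>
    have "((\<lambda>e. inner e (\<rho> e) * (norm (X e - expectation \<rho> X *\<^sub>C e))\<^sup>2) has_sum Re (ctrace (P X \<circ> P X \<circ> \<Omega>))) E"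
    proof (rule has_sum_tensor_marginal[OF t on total[unfolded G_def] sumF])
      fix e f assume "e \<in> E" "f \<in> F"
      thus "inner (t e f) (\<Omega> (t e f)) * (norm (P X (t e f)))\<^sup>2 =
          inner f (\<rho>\<^sub>a\<^sub>p\<^sub>p f) *\<^sub>R (inner e (\<rho> e) * (norm (X e - expectation \<rho> X *\<^sub>C e))\<^sup>2)"
        by (simp add: ten(3) Pt[OF X] norm_tensor[OF t] orthonormal_norm[OF on(2)])
    qed
    hence "Re (ctrace (P X \<circ> P X \<circ> \<Omega>)) = (std_deviation \<rho> X)\<^sup>2"
      using has_sum_std_deviation[OF \<rho> E summE X] by (rule has_sum_unique)
    thus ?thesis using total by simp
  qed
  have com: "ctrace (commutator (P A) (P B) \<circ> \<Omega>) = expectation \<rho> (commutator A B)"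
  proof -
    note bA = hermitian_op_bounded_clinear[OF A] and bB = hermitian_op_bounded_clinear[OF B]
    have total: "((\<lambda>g. complex_of_real (inner g (\<Omega> g)) * cinner g (commutator (P A) (P B) g)) has_sum
        ctrace (commutator (P A) (P B) \<circ> \<Omega>)) G"
      by (rule ctrace_comp[OF ten(1,2) summG bounded_clinear_commutator])
         (rule hermitian_op_bounded_clinear[OF hP[OF A]], rule hermitian_op_bounded_clinear[OF hP[OF B]])
    have "((\<lambda>e. complex_of_real (inner e (\<rho> e)) * cinner e (commutator A B e)) has_sum
        ctrace (commutator (P A) (P B) \<circ> \<Omega>)) E"
    proof (rule has_sum_tensor_marginal[OF t on total[unfolded G_def] sumF])
      fix e f assume ef: "e \<in> E" "f \<in> F"
      \<comment> \<open>The means drop out of the commutator, which acts on the first factor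
        alone.\<close>
      have "commutator (P A) (P B) (t e f) = t (commutator A B e) f"
        unfolding commutator_def Pt[OF A] Pt[OF B] bounded_clinear_diff[OF bounded_clinear_tensor_left[OF t], symmetric]
        by (simp add: bounded_clinear_diff[OF bA] bounded_clinear_diff[OF bB] bounded_clinear_scaleC[OF bA]
            bounded_clinear_scaleC[OF bB] complex_vector.scale_right_diff_distrib scaleC_scaleC mult.commute)
      thus "complex_of_real (inner (t e f) (\<Omega> (t e f))) * cinner (t e f) (commutator (P A) (P B) (t e f)) =
          inner f (\<rho>\<^sub>a\<^sub>p\<^sub>p f) *\<^sub>R (complex_of_real (inner e (\<rho> e)) * cinner e (commutator A B e))"
        using ef by (simp add: ten(3) cinner_tensor[OF t] orthonormal_cinner[OF on(2)] scaleR_conv_of_real)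
    qed
    moreover have "((\<lambda>e. complex_of_real (inner e (\<rho> e)) * cinner e (commutator A B e)) has_sum
        expectation \<rho> (commutator A B)) E"
      unfolding expectation_def by (rule ctrace_comp[OF \<rho> E summE bounded_clinear_commutator[OF bA bB]])
    ultimately show ?thesis by (rule has_sum_unique)
  qed

  have bt: "bounded_clinear (tensor_op t id Xa)" and tt: "tensor_op t id Xa (t x y) = t x (Xa y)"
    if "hermitian_op Xa" for Xa x y
    using tensor_op[OF t onb bounded_clinear_id hermitian_op_bounded_clinear[OF that]] by auto
  have "(\<lambda>z. tensor_op t id A\<^sub>a\<^sub>p\<^sub>p (tensor_op t id B\<^sub>a\<^sub>p\<^sub>p z)) = (\<lambda>z. tensor_op t id B\<^sub>a\<^sub>p\<^sub>p (tensor_op t id A\<^sub>a\<^sub>p\<^sub>p z))"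
  proof (rule tensor_eqI[OF t bounded_clinear_comp[OF bt[OF assms(13)] bt[OF assms(14)]]
        bounded_clinear_comp[OF bt[OF assms(14)] bt[OF assms(13)]]])
    show "tensor_op t id A\<^sub>a\<^sub>p\<^sub>p (tensor_op t id B\<^sub>a\<^sub>p\<^sub>p (t x y)) = tensor_op t id B\<^sub>a\<^sub>p\<^sub>p (tensor_op t id A\<^sub>a\<^sub>p\<^sub>p (t x y))" for x y
      using fun_cong[OF assms(15), of y] by (simp add: tt[OF assms(13)] tt[OF assms(14)])
  qed
  \<comment> \<open>The inner factor U U^dagger cancels, so the evolved meters commute because the
    meters do.\<close>
  hence MM: "M A\<^sub>a\<^sub>p\<^sub>p (M B\<^sub>a\<^sub>p\<^sub>p z) = M B\<^sub>a\<^sub>p\<^sub>p (M A\<^sub>a\<^sub>p\<^sub>p z)" for z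
    by (simp add: M_def UU fun_eq_iff)
  \<comment> \<open>The terms X \<otimes> 1 cancel, leaving the evolved meter minus a
    scalar.\<close>
  have NP: "noise_op t U X Xa z + P X z = M Xa z - expectation \<rho> X *\<^sub>C z" for X Xa z
    by (simp add: N P_def)
  note bMA = hermitian_op_bounded_clinear[OF hM[OF assms(13)]] and bMB = hermitian_op_bounded_clinear[OF hM[OF assms(14)]]
  have comm: "commutator (\<lambda>z. noise_op t U A A\<^sub>a\<^sub>p\<^sub>p z + P A z) (\<lambda>z. noise_op t U B B\<^sub>a\<^sub>p\<^sub>p z + P B z) z = 0" for z
    unfolding commutator_def NP
    by (simp add: bounded_clinear_diff[OF bMA] bounded_clinear_diff[OF bMB] bounded_clinear_scaleC[OF bMA]
        bounded_clinear_scaleC[OF bMB] MM complex_vector.scale_right_diff_distrib scaleC_scaleC mult.commute)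

  have "cmod (expectation \<rho> (commutator A B)) \<le> 2 * ((L - m) / (L + m)) *
     (measurement_error t \<rho> \<rho>\<^sub>a\<^sub>p\<^sub>p U A A\<^sub>a\<^sub>p\<^sub>p * measurement_error t \<rho> \<rho>\<^sub>a\<^sub>p\<^sub>p U B B\<^sub>a\<^sub>p\<^sub>p
       + measurement_error t \<rho> \<rho>\<^sub>a\<^sub>p\<^sub>p U A A\<^sub>a\<^sub>p\<^sub>p * sqrt ((std_deviation \<rho> B)\<^sup>2)
       + sqrt ((std_deviation \<rho> A)\<^sup>2) * measurement_error t \<rho> \<rho>\<^sub>a\<^sub>p\<^sub>p U B B\<^sub>a\<^sub>p\<^sub>p)"
    unfolding measurement_error_def Let_def \<Omega>_def[symmetric] com[symmetric]
    by (rule cmod_ctrace_commutator_le_if_sums_commute[OF ten(1,2) summG bounds mL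
          hN[OF A assms(13)] hN[OF B assms(14)] hP[OF A] hP[OF B] comm
          err[OF A assms(13)] err[OF B assms(14)] dev[OF A] dev[OF B]])
  moreover have "sqrt ((std_deviation \<rho> X)\<^sup>2) = std_deviation \<rho> X" if "hermitian_op X" for X
    using std_deviation_nonneg[OF \<rho> E summE that] by simp
  ultimately have "cmod (expectation \<rho> (commutator A B)) \<le> 2 * ((L - m) / (L + m)) *
     (measurement_error t \<rho> \<rho>\<^sub>a\<^sub>p\<^sub>p U A A\<^sub>a\<^sub>p\<^sub>p * measurement_error t \<rho> \<rho>\<^sub>a\<^sub>p\<^sub>p U B B\<^sub>a\<^sub>p\<^sub>p
       + measurement_error t \<rho> \<rho>\<^sub>a\<^sub>p\<^sub>p U A A\<^sub>a\<^sub>p\<^sub>p * std_deviation \<rho> B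
       + std_deviation \<rho> A * measurement_error t \<rho> \<rho>\<^sub>a\<^sub>p\<^sub>p U B B\<^sub>a\<^sub>p\<^sub>p)" (is "?c \<le> 2 * _ * ?R")
    using A B by simp
  \<comment> \<open>The multiplier is the inverse of the prefactor and is positive because 0 \<le> m
    < L.\<close>
  hence "(L + m) / (2 * (L - m)) * ?c \<le> (L + m) / (2 * (L - m)) * (2 * ((L - m) / (L + m)) * ?R)"
    using mL by (intro mult_left_mono) auto
  also have "\<dots> = ?R" using mL by simp
  finally show ?thesis by (simp only: L_def m_def)
qed

end
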